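(* Let $\mathcal{Q}$ be a conjugate-invariant subfield of $\mathbb{C}$. If $(X,L)$ is a real algebraic variety defined over $\mathcal{Q}$, then $(X,L)$ is definable over $\mathcal{Q}\cap\mathbb{R}$.
   Context: $J_n:\mathbb{C}^n\to\mathbb{C}^n$ denotes the usual conjugation map $J_n(x_1,\ldots,x_n)=(\overline{x_1},\ldots,\overline{x_n})$. Let $X\subset\mathbb{C}^n$ be a complex smooth algebraic variety (the zero set of finitely many polynomials) and set $\overline{X}=J_n(X)$. A symmetry of $X$ is an antiholomorphic automorphism $L:X\to X$ of order two such that $J_n\circ L:X\to\overline{X}$ is a biregular isomorphism. A real algebraic variety is a pair $(X,L)$ where $X$ is a complex smooth algebraic variety and $L$ is a symmetry of $X$. Two real algebraic varieties $(X,L)$ and $(Y,T)$ are isomorphic if there is a birational isomorphism $R:X\to Y$ with $T=R\circ L\circ R^{-1}$. For a subfield $\mathcal{F}$ of $\mathbb{C}$: $(X,L)$ is defined over $\mathcal{F}$ if both $X$ and $J_n\circ L$ are defined over $\mathcal{F}$ (by polynomials, respectively rational functions, with coefficients in $\mathcal{F}$); $(X,L)$ is definable over $\mathcal{F}$ if there is a real algebraic variety $(Y,T)$ defined over $\mathcal{F}$ and isomorphic to $(X,L)$. A subfield $\mathcal{Q}$ of $\mathbb{C}$ is conjugate-invariant if $J_1(\mathcal{Q})=\mathcal{Q}$. *)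

theory Defs
  imports
    "HOL-Analysis.Analysis"
    "HOL-Library.Poly_Mapping"
    "HOL-Library.Function_Algebras"
    "HOL-Library.Extended_Nat"
    "HOL-Algebra.Subrings"
begin

section \<open>Affine space and polynomials\<close>

text \<open>
  The dimension of the ambient space has to be quantified over, so \<open>\<complex>\<^sup>n\<close> is the set of complex
  sequences that vanish from index \<open>n\<close> on. The (product) topology of the type
  \<open>nat \<Rightarrow> complex\<close> induces the Euclidean topology on it.
\<close>

type_synonym cvec = "nat \<Rightarrow> complex"

definition Cn :: "nat \<Rightarrow> cvec set" where
  "Cn n = {x. \<forall>i\<ge>n. x i = 0}"

definition conj_map :: "cvec \<Rightarrow> cvec" where
  "conj_map x = (\<lambda>i. cnj (x i))"

definition cscale :: "complex \<Rightarrow> cvec \<Rightarrow> cvec" where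
  "cscale c v = (\<lambda>i. c * v i)"

global_interpretation cvec: vector_space cscale
  by unfold_locales (auto simp: cscale_def fun_eq_iff algebra_simps)

text \<open>Polynomials are finitely supported maps from exponents (monomials) to coefficients.\<close>

type_synonym cpoly = "(nat \<Rightarrow>\<^sub>0 nat) \<Rightarrow>\<^sub>0 complex"

definition polys :: "complex set \<Rightarrow> nat \<Rightarrow> cpoly set" where
  "polys F n = {p. range (Poly_Mapping.lookup p) \<subseteq> F \<and>
     (\<forall>e\<in>Poly_Mapping.keys p. Poly_Mapping.keys e \<subseteq> {..<n})}"

definition peval :: "cpoly \<Rightarrow> cvec \<Rightarrow> complex" where
  "peval p x = (\<Sum>e\<in>Poly_Mapping.keys p. Poly_Mapping.lookup p e *
     (\<Prod>i\<in>Poly_Mapping.keys e. x i ^ Poly_Mapping.lookup e i))"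

definition partial_at :: "nat \<Rightarrow> cpoly \<Rightarrow> cvec \<Rightarrow> complex" where
  "partial_at i p x = deriv (\<lambda>t. peval p (x(i := t))) (x i)"

definition complex_ring :: "complex ring" where
  "complex_ring = \<lparr>carrier = UNIV, mult = (*), one = 1, zero = 0, add = (+)\<rparr>"

section \<open>Algebraic sets and the Zariski topology\<close>

definition zero_set :: "nat \<Rightarrow> cpoly set \<Rightarrow> cvec set" where
  "zero_set n P = {x \<in> Cn n. \<forall>p\<in>P. peval p x = 0}"

definition algebraic_set_over :: "complex set \<Rightarrow> nat \<Rightarrow> cvec set \<Rightarrow> bool" where
  "algebraic_set_over F n X \<longleftrightarrow> (\<exists>P. finite P \<and> P \<subseteq> polys F n \<and> X = zero_set n P)"

definition vanishing_ideal :: "nat \<Rightarrow> cvec set \<Rightarrow> cpoly set" where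
  "vanishing_ideal n S = {p \<in> polys UNIV n. \<forall>x\<in>S. peval p x = 0}"

definition zariski_closure :: "nat \<Rightarrow> cvec set \<Rightarrow> cvec set" where
  "zariski_closure n S = zero_set n (vanishing_ideal n S)"

definition zariski_closed :: "nat \<Rightarrow> cvec set \<Rightarrow> bool" where
  "zariski_closed n Z \<longleftrightarrow> (\<exists>P \<subseteq> polys UNIV n. Z = zero_set n P)"

definition zariski_dense_in :: "nat \<Rightarrow> cvec set \<Rightarrow> cvec set \<Rightarrow> bool" where
  "zariski_dense_in n X D \<longleftrightarrow> D \<subseteq> X \<and> X \<subseteq> zariski_closure n D"

definition irreducible_closed :: "nat \<Rightarrow> cvec set \<Rightarrow> bool" where
  "irreducible_closed n Z \<longleftrightarrow> zariski_closed n Z \<and> Z \<noteq> {} \<and>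
     (\<forall>A B. zariski_closed n A \<and> zariski_closed n B \<and> Z = A \<union> B \<longrightarrow> Z = A \<or> Z = B)"

section \<open>Smoothness\<close>

text \<open>
  The local dimension at \<open>x\<close> is the Krull dimension of the local ring at \<open>x\<close>, expressed by chains
  of irreducible closed subsets of \<open>X\<close> through \<open>x\<close>. Smoothness at \<open>x\<close> says that the Zariski
  tangent space has that dimension.
\<close>

definition local_dim :: "nat \<Rightarrow> cvec set \<Rightarrow> cvec \<Rightarrow> enat" where
  "local_dim n X x = Sup {enat d | d. \<exists>Z :: nat \<Rightarrow> cvec set.
      (\<forall>i\<le>d. irreducible_closed n (Z i) \<and> x \<in> Z i \<and> Z i \<subseteq> X) \<and>
      (\<forall>i<d. Z i \<subset> Z (Suc i))}"

definition tangent_space :: "nat \<Rightarrow> cvec set \<Rightarrow> cvec \<Rightarrow> cvec set" where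
  "tangent_space n X x =
     {v \<in> Cn n. \<forall>p\<in>vanishing_ideal n X. (\<Sum>i<n. partial_at i p x * v i) = 0}"

definition smooth_at :: "nat \<Rightarrow> cvec set \<Rightarrow> cvec \<Rightarrow> bool" where
  "smooth_at n X x \<longleftrightarrow> enat (cvec.dim (tangent_space n X x)) = local_dim n X x"

definition smooth_variety :: "nat \<Rightarrow> cvec set \<Rightarrow> bool" where
  "smooth_variety n X \<longleftrightarrow> algebraic_set_over UNIV n X \<and> (\<forall>x\<in>X. smooth_at n X x)"

section \<open>Regular, holomorphic and rational maps\<close>

definition regular_map :: "nat \<Rightarrow> cvec set \<Rightarrow> nat \<Rightarrow> cvec set \<Rightarrow> (cvec \<Rightarrow> cvec) \<Rightarrow> bool" where
  "regular_map n X m Y f \<longleftrightarrow> f ` X \<subseteq> Y \<and>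
     (\<exists>p. (\<forall>i<m. p i \<in> polys UNIV n) \<and>
          (\<forall>x\<in>X. f x = (\<lambda>i. if i < m then peval (p i) x else 0)))"

definition biregular_iso :: "nat \<Rightarrow> cvec set \<Rightarrow> nat \<Rightarrow> cvec set \<Rightarrow> (cvec \<Rightarrow> cvec) \<Rightarrow> bool" where
  "biregular_iso n X m Y f \<longleftrightarrow> bij_betw f X Y \<and>
     regular_map n X m Y f \<and> regular_map m Y n X (inv_into X f)"

text \<open>
  A function of several complex variables is holomorphic if it is continuous and holomorphic in
  each variable; a function on a subvariety is holomorphic if it locally extends to such a
  function on an open subset of \<open>\<complex>\<^sup>n\<close>.
\<close>

definition holomorphic_on_open :: "nat \<Rightarrow> cvec set \<Rightarrow> (cvec \<Rightarrow> complex) \<Rightarrow> bool" where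
  "holomorphic_on_open n N g \<longleftrightarrow> continuous_on (N \<inter> Cn n) g \<and>
     (\<forall>x\<in>N \<inter> Cn n. \<forall>i<n. (\<lambda>t. g (x(i := t))) field_differentiable at (x i))"

definition holomorphic_function :: "nat \<Rightarrow> cvec set \<Rightarrow> (cvec \<Rightarrow> complex) \<Rightarrow> bool" where
  "holomorphic_function n X f \<longleftrightarrow> (\<forall>x\<in>X. \<exists>N g. open N \<and> x \<in> N \<and>
     holomorphic_on_open n N g \<and> (\<forall>y\<in>N \<inter> X. f y = g y))"

definition antiholomorphic_map :: "nat \<Rightarrow> cvec set \<Rightarrow> (cvec \<Rightarrow> cvec) \<Rightarrow> bool" where
  "antiholomorphic_map n X L \<longleftrightarrow> (\<forall>i<n. holomorphic_function n X (\<lambda>x. cnj (L x i)))"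

text \<open>
  A rational map into \<open>\<complex>\<^sup>m\<close> is given by numerators and denominators \<open>r 0, \<dots>, r (m - 1)\<close>. The
  denominators have to be nonzero on a Zariski dense (and automatically open) subset of \<open>X\<close>, so
  that no denominator vanishes identically on a component of \<open>X\<close>.
\<close>

type_synonym rat_tuple = "nat \<Rightarrow> cpoly \<times> cpoly"

definition rat_dom :: "nat \<Rightarrow> rat_tuple \<Rightarrow> cvec set \<Rightarrow> cvec set" where
  "rat_dom m r X = {x \<in> X. \<forall>i<m. peval (snd (r i)) x \<noteq> 0}"

definition rat_eval :: "nat \<Rightarrow> rat_tuple \<Rightarrow> cvec \<Rightarrow> cvec" where
  "rat_eval m r x = (\<lambda>i. if i < m then peval (fst (r i)) x / peval (snd (r i)) x else 0)"

definition rational_map ::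
  "complex set \<Rightarrow> nat \<Rightarrow> cvec set \<Rightarrow> nat \<Rightarrow> cvec set \<Rightarrow> rat_tuple \<Rightarrow> bool" where
  "rational_map F n X m Y r \<longleftrightarrow>
     (\<forall>i<m. fst (r i) \<in> polys F n \<and> snd (r i) \<in> polys F n) \<and>
     zariski_dense_in n X (rat_dom m r X) \<and> rat_eval m r ` rat_dom m r X \<subseteq> Y"

definition rational_left_inverse ::
  "nat \<Rightarrow> cvec set \<Rightarrow> nat \<Rightarrow> cvec set \<Rightarrow> rat_tuple \<Rightarrow> rat_tuple \<Rightarrow> bool" where
  "rational_left_inverse n X m Y r s \<longleftrightarrow> zariski_dense_in n X
     {x \<in> rat_dom m r X. rat_eval m r x \<in> rat_dom n s Y \<and> rat_eval n s (rat_eval m r x) = x}"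

definition birational_iso ::
  "nat \<Rightarrow> cvec set \<Rightarrow> nat \<Rightarrow> cvec set \<Rightarrow> rat_tuple \<Rightarrow> rat_tuple \<Rightarrow> bool" where
  "birational_iso n X m Y r s \<longleftrightarrow>
     rational_map UNIV n X m Y r \<and> rational_map UNIV m Y n X s \<and>
     rational_left_inverse n X m Y r s \<and> rational_left_inverse m Y n X s r"

section \<open>Real algebraic varieties\<close>

definition symmetry :: "nat \<Rightarrow> cvec set \<Rightarrow> (cvec \<Rightarrow> cvec) \<Rightarrow> bool" where
  "symmetry n X L \<longleftrightarrow> bij_betw L X X \<and> antiholomorphic_map n X L \<and>
     (\<forall>x\<in>X. L (L x) = x) \<and> (\<exists>x\<in>X. L x \<noteq> x) \<and>
     biregular_iso n X n (conj_map ` X) (conj_map \<circ> L)"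

definition real_algebraic_variety :: "nat \<Rightarrow> cvec set \<Rightarrow> (cvec \<Rightarrow> cvec) \<Rightarrow> bool" where
  "real_algebraic_variety n X L \<longleftrightarrow> smooth_variety n X \<and> symmetry n X L"

text \<open>
  The identity \<open>T = R \<circ> L \<circ> R\<^sup>-\<^sup>1\<close> involves rational maps, so it is required on a Zariski dense
  subset of \<open>Y\<close> on which the right-hand side is defined.
\<close>

definition real_isomorphic ::
  "nat \<Rightarrow> cvec set \<Rightarrow> (cvec \<Rightarrow> cvec) \<Rightarrow> nat \<Rightarrow> cvec set \<Rightarrow> (cvec \<Rightarrow> cvec) \<Rightarrow> bool" where
  "real_isomorphic n X L m Y T \<longleftrightarrow> (\<exists>r s. birational_iso n X m Y r s \<and>
     zariski_dense_in m Y {y \<in> rat_dom n s Y. L (rat_eval n s y) \<in> rat_dom m r X \<and>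
        T y = rat_eval m r (L (rat_eval n s y))})"

definition map_defined_over ::
  "complex set \<Rightarrow> nat \<Rightarrow> cvec set \<Rightarrow> nat \<Rightarrow> cvec set \<Rightarrow> (cvec \<Rightarrow> cvec) \<Rightarrow> bool" where
  "map_defined_over F n X m Y f \<longleftrightarrow> (\<exists>r. rational_map F n X m Y r \<and>
     (\<forall>x\<in>rat_dom m r X. f x = rat_eval m r x))"

definition defined_over :: "complex set \<Rightarrow> nat \<Rightarrow> cvec set \<Rightarrow> (cvec \<Rightarrow> cvec) \<Rightarrow> bool" where
  "defined_over F n X L \<longleftrightarrow> algebraic_set_over F n X \<and>
     map_defined_over F n X n (conj_map ` X) (conj_map \<circ> L)"

definition definable_over :: "complex set \<Rightarrow> nat \<Rightarrow> cvec set \<Rightarrow> (cvec \<Rightarrow> cvec) \<Rightarrow> bool" where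
  "definable_over F n X L \<longleftrightarrow> (\<exists>m Y T. real_algebraic_variety m Y T \<and>
     defined_over F m Y T \<and> real_isomorphic n X L m Y T)"

end

theory Submission
  imports Defs "HOL-Computational_Algebra.Fundamental_Theorem_Algebra"
begin

text \<open>
  Write \<open>\<psi>\<close> for the complex conjugate of \<open>L\<close>. It is a polynomial map on \<open>X\<close>, and on a dense open
  subset it is given by fractions with coefficients in \<open>Q\<close>. If \<open>Q\<close> is real there is nothing to prove.
  Otherwise \<open>Q\<close> contains a number \<open>w \<noteq> 0\<close> with \<open>cnj w = - w\<close>, and the map
  \<open>x \<mapsto> (x + \<psi> x, w (x - \<psi> x))\<close> turns \<open>L\<close> into coordinatewise conjugation: replacing \<open>x\<close> by \<open>L x\<close>
  and conjugating exchanges \<open>x\<close> and \<open>\<psi> x\<close>, and the two sign changes in the second component cancel.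
  An algebraic set over \<open>Q\<close> that is stable under conjugation is an algebraic set over \<open>Q \<inter> \<real>\<close>,
  because every polynomial over \<open>Q\<close> is \<open>f\<^sub>1 + w f\<^sub>2\<close> with \<open>f\<^sub>1\<close>, \<open>f\<^sub>2\<close> over \<open>Q \<inter> \<real>\<close>
  (\<open>conj_invariant_imp_algebraic_over_reals\<close>). So the image, together with conjugation, is a model
  over the real subfield, provided that the image is defined over \<open>Q\<close>.

  It is not obvious that the image of all of \<open>X\<close> is defined over \<open>Q\<close>, since the polynomials that give
  \<open>\<psi>\<close> everywhere have arbitrary complex coefficients. Isomorphism is only required birationally,
  however, so \<open>X\<close> may be replaced by the principal open subset \<open>U\<close> where the common denominator \<open>h\<close> of
  the fractions vanishes neither at \<open>x\<close> nor at \<open>L x\<close>. With one more coordinate, the inverse \<open>t\<close> of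
  \<open>g x = h x * cnj (h (L x))\<close>, the image of \<open>U\<close> is a closed set \<open>Y\<close> whose equations can be written down
  with coefficients in \<open>Q\<close>. The extra coordinate respects the symmetry because \<open>g (L x) = cnj (g x)\<close>.

  Shrinking \<open>X\<close> leaves two things to check. First, \<open>Y\<close> is smooth: local dimension and Zariski tangent
  spaces do not change when a principal open subset is embedded as a closed set (locale
  \<open>principal_open_chart\<close>). Second, conjugation must not be the identity on \<open>Y\<close>, although a priori all
  points that \<open>L\<close> moves could lie outside \<open>U\<close>. If it were the identity, all points of \<open>Y\<close> would be
  real, and a complex algebraic set with only real points is finite
  (\<open>zariski_closed_real_imp_finite\<close>, a consequence of the Nullstellensatz). Then \<open>U\<close> would be finite,
  hence closed, and being dense it would be all of \<open>X\<close>, so \<open>L\<close> would be the identity.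
\<close>

section \<open>Polynomial functions\<close>

text \<open>
  Only the functions defined by polynomials matter below. Generating them inductively gives an
  induction principle in which sums and products are the only steps.
\<close>

inductive polyfun :: "complex set \<Rightarrow> nat \<Rightarrow> (cvec \<Rightarrow> complex) \<Rightarrow> bool" for F n where
  const: "c \<in> F \<Longrightarrow> polyfun F n (\<lambda>_. c)"
| coord: "i < n \<Longrightarrow> polyfun F n (\<lambda>x. x i)"
| add: "polyfun F n f \<Longrightarrow> polyfun F n g \<Longrightarrow> polyfun F n (\<lambda>x. f x + g x)"
| mult: "polyfun F n f \<Longrightarrow> polyfun F n g \<Longrightarrow> polyfun F n (\<lambda>x. f x * g x)"

text \<open>
  The closure properties of a subfield, on elements of the type rather than on a ring record.
\<close>

definition complex_subfield :: "complex set \<Rightarrow> bool" where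
  "complex_subfield F \<longleftrightarrow> 0 \<in> F \<and> 1 \<in> F \<and>
     (\<forall>a\<in>F. \<forall>b\<in>F. a + b \<in> F \<and> a * b \<in> F) \<and> (\<forall>a\<in>F. - a \<in> F \<and> inverse a \<in> F)"

lemma complex_subfieldD:
  assumes "complex_subfield F"
  shows "0 \<in> F" "1 \<in> F" "\<And>a b. a \<in> F \<Longrightarrow> b \<in> F \<Longrightarrow> a + b \<in> F"
    "\<And>a b. a \<in> F \<Longrightarrow> b \<in> F \<Longrightarrow> a * b \<in> F" "\<And>a. a \<in> F \<Longrightarrow> - a \<in> F" "\<And>a. a \<in> F \<Longrightarrow> inverse a \<in> F"
  using assms unfolding complex_subfield_def by auto

lemma complex_subfield_UNIV [simp]: "complex_subfield UNIV"
  by (simp add: complex_subfield_def)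

lemma complex_subfield_diff:
  assumes "complex_subfield F" "a \<in> F" "b \<in> F"
  shows "a - b \<in> F"
  using complex_subfieldD(3)[OF assms(1,2) complex_subfieldD(5)[OF assms(1,3)]] by simp

lemma complex_subfield_divide:
  assumes "complex_subfield F" "a \<in> F" "b \<in> F"
  shows "a / b \<in> F"
  using complex_subfieldD(4)[OF assms(1,2) complex_subfieldD(6)[OF assms(1,3)]] by (simp add: divide_inverse)

lemma subfield_imp_complex_subfield:
  assumes "subfield Q complex_ring"
  shows "complex_subfield Q"
proof -
  interpret subfield Q complex_ring by (rule assms)
  have cl: "a + b \<in> Q" "a * b \<in> Q" if "a \<in> Q" "b \<in> Q" for a b
    using subfieldE(1)[OF assms] subringE(6,7) that
    by (fastforce simp: complex_ring_def)+
  have o: "0 \<in> Q" "1 \<in> Q"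
    using subringE(2,3)[OF subfieldE(1)[OF assms]] by (auto simp: complex_ring_def)
  have neg: "- a \<in> Q" if "a \<in> Q" for a
  proof -
    have "\<ominus>\<^bsub>complex_ring\<^esub> a \<in> Q"
      using subringE(5)[OF subfieldE(1)[OF assms] that] .
    moreover have "\<ominus>\<^bsub>complex_ring\<^esub> a = - a"
      unfolding a_inv_def m_inv_def complex_ring_def
      by (auto intro!: the_equality simp: add_eq_0_iff)
    ultimately show ?thesis by simp
  qed
  have inv: "inverse a \<in> Q" if "a \<in> Q" for a
  proof (cases "a = 0")
    case False
    hence "a \<in> Units (complex_ring \<lparr>carrier := Q\<rparr>)"
      using that subfield_Units by (auto simp: complex_ring_def)
    then obtain b where b: "b \<in> Q" "b * a = 1"
      by (auto simp: Units_def complex_ring_def)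
    hence "b = inverse a" by (metis False inverse_unique mult.commute)
    with b show ?thesis by simp
  qed (use o in auto)
  show ?thesis unfolding complex_subfield_def using cl o neg inv by auto
qed

lemma polyfun_mono: "polyfun F n f \<Longrightarrow> F \<subseteq> G \<Longrightarrow> n \<le> m \<Longrightarrow> polyfun G m f"
  by (induction rule: polyfun.induct) (auto intro: polyfun.intros)

lemma polyfun_UNIV: "polyfun F n f \<Longrightarrow> polyfun UNIV n f"
  by (rule polyfun_mono) auto

lemma polyfun_uminus:
  assumes "complex_subfield F" "polyfun F n f"
  shows "polyfun F n (\<lambda>x. - f x)"
proof -
  have "polyfun F n (\<lambda>x. (-1) * f x)"
    by (intro polyfun.intros complex_subfieldD[OF assms(1)] assms)
  thus ?thesis by simp
qed

lemma polyfun_diff: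
  assumes "complex_subfield F" "polyfun F n f" "polyfun F n g"
  shows "polyfun F n (\<lambda>x. f x - g x)"
  using polyfun.add[OF assms(2) polyfun_uminus[OF assms(1,3)]] by simp

lemma polyfun_divide_const:
  assumes "complex_subfield F" "polyfun F n f" "c \<in> F"
  shows "polyfun F n (\<lambda>x. f x / c)"
  using polyfun.mult[OF assms(2) polyfun.const[OF complex_subfieldD(6)[OF assms(1,3)]]]
  by (simp add: divide_inverse)

lemma polyfun_power:
  assumes "complex_subfield F" "polyfun F n f"
  shows "polyfun F n (\<lambda>x. f x ^ k)"
  by (induction k) (auto intro: polyfun.intros assms complex_subfieldD)

lemma polyfun_sum:
  assumes "complex_subfield F" "\<And>a. a \<in> A \<Longrightarrow> polyfun F n (f a)"
  shows "polyfun F n (\<lambda>x. \<Sum>a\<in>A. f a x)"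
  using assms(2)
  by (induction A rule: infinite_finite_induct) (auto intro: polyfun.intros complex_subfieldD[OF assms(1)])

lemma polyfun_prod:
  assumes "complex_subfield F" "\<And>a. a \<in> A \<Longrightarrow> polyfun F n (f a)"
  shows "polyfun F n (\<lambda>x. \<Prod>a\<in>A. f a x)"
  using assms(2)
  by (induction A rule: infinite_finite_induct) (auto intro: polyfun.intros complex_subfieldD[OF assms(1)])

lemmas polyfun_intros = polyfun.intros polyfun_uminus polyfun_diff polyfun_divide_const
  polyfun_power polyfun_sum polyfun_prod

lemma polyfun_compose:
  assumes "polyfun F k f" "\<And>i. i < k \<Longrightarrow> polyfun F m (\<lambda>y. s y i)"
  shows "polyfun F m (\<lambda>y. f (s y))"
  using assms by (induction rule: polyfun.induct) (auto intro: polyfun.intros)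

text \<open>
  This function is the polynomial whose coefficients are the conjugates of those of \<open>f\<close>.
\<close>

lemma polyfun_cnj:
  assumes "polyfun F n f"
  shows "polyfun (cnj ` F) n (\<lambda>x. cnj (f (conj_map x)))"
  using assms by (induction rule: polyfun.induct) (auto intro: polyfun.intros simp: conj_map_def)

lemma conj_map_conj_map [simp]: "conj_map (conj_map x) = x"
  by (simp add: conj_map_def)

section \<open>Polynomials and polynomial functions\<close>

definition monomial_fun :: "(nat \<Rightarrow>\<^sub>0 nat) \<Rightarrow> cvec \<Rightarrow> complex" where
  "monomial_fun e x = (\<Prod>i\<in>Poly_Mapping.keys e. x i ^ Poly_Mapping.lookup e i)"

lemma monomial_fun_superset:
  assumes "finite S" "Poly_Mapping.keys e \<subseteq> S"
  shows "monomial_fun e x = (\<Prod>i\<in>S. x i ^ Poly_Mapping.lookup e i)"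
  unfolding monomial_fun_def
  by (rule prod.mono_neutral_left) (use assms in \<open>auto simp: in_keys_iff\<close>)

lemma monomial_fun_add: "monomial_fun (d + e) x = monomial_fun d x * monomial_fun e x"
proof -
  let ?S = "Poly_Mapping.keys d \<union> Poly_Mapping.keys e"
  have *: "finite ?S" by simp
  show ?thesis
    using monomial_fun_superset[OF *, of "d + e" x] monomial_fun_superset[OF *, of d x]
      monomial_fun_superset[OF *, of e x] Poly_Mapping.keys_add[of d e]
    by (simp add: lookup_add power_add prod.distrib)
qed

lemma peval_superset:
  assumes "finite S" "Poly_Mapping.keys p \<subseteq> S"
  shows "peval p x = (\<Sum>e\<in>S. Poly_Mapping.lookup p e * monomial_fun e x)"
  unfolding peval_def monomial_fun_def
  by (rule sum.mono_neutral_left) (use assms in \<open>auto simp: in_keys_iff\<close>)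

lemma peval_add: "peval (p + q) x = peval p x + peval q x"
proof -
  let ?S = "Poly_Mapping.keys p \<union> Poly_Mapping.keys q"
  have *: "finite ?S" by simp
  show ?thesis
    using peval_superset[OF *, of "p + q" x] peval_superset[OF *, of p x]
      peval_superset[OF *, of q x] Poly_Mapping.keys_add[of p q]
    by (simp add: lookup_add ring_distribs sum.distrib)
qed

lemma peval_zero [simp]: "peval 0 x = 0"
  by (simp add: peval_def)

lemma peval_sum: "peval (\<Sum>a\<in>A. f a) x = (\<Sum>a\<in>A. peval (f a) x)"
  by (induction A rule: infinite_finite_induct) (auto simp: peval_add)

lemma peval_single: "peval (Poly_Mapping.single e c) x = c * monomial_fun e x"
  using peval_superset[of "{e}" "Poly_Mapping.single e c" x] by auto

lemma sum_single_lookup: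
  fixes p :: "'a \<Rightarrow>\<^sub>0 'b::comm_monoid_add"
  shows "(\<Sum>e\<in>Poly_Mapping.keys p. Poly_Mapping.single e (Poly_Mapping.lookup p e)) = p"
proof (rule poly_mapping_eqI)
  fix k
  have "Poly_Mapping.lookup (\<Sum>e\<in>Poly_Mapping.keys p. Poly_Mapping.single e (Poly_Mapping.lookup p e)) k
      = (\<Sum>e\<in>Poly_Mapping.keys p. if e = k then Poly_Mapping.lookup p e else 0)"
    by (simp add: lookup_sum lookup_single when_def)
  also have "\<dots> = Poly_Mapping.lookup p k"
    by (simp add: in_keys_iff)
  finally show "Poly_Mapping.lookup (\<Sum>e\<in>Poly_Mapping.keys p. Poly_Mapping.single e (Poly_Mapping.lookup p e)) k
    = Poly_Mapping.lookup p k" .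
qed

lemma polymult_expand:
  fixes p q :: cpoly
  shows "p * q = (\<Sum>d\<in>Poly_Mapping.keys p. \<Sum>e\<in>Poly_Mapping.keys q.
    Poly_Mapping.single (d + e) (Poly_Mapping.lookup p d * Poly_Mapping.lookup q e))"
proof -
  have "p * q = (\<Sum>d\<in>Poly_Mapping.keys p. Poly_Mapping.single d (Poly_Mapping.lookup p d))
      * (\<Sum>e\<in>Poly_Mapping.keys q. Poly_Mapping.single e (Poly_Mapping.lookup q e))"
    by (simp only: sum_single_lookup)
  thus ?thesis by (simp only: sum_product mult_single)
qed

lemma peval_mult: "peval (p * q) x = peval p x * peval q x"
proof -
  have "peval p x * peval q x = (\<Sum>d\<in>Poly_Mapping.keys p. \<Sum>e\<in>Poly_Mapping.keys q.
      (Poly_Mapping.lookup p d * monomial_fun d x) * (Poly_Mapping.lookup q e * monomial_fun e x))"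
    by (simp only: peval_def monomial_fun_def sum_product)
  also have "\<dots> = peval (p * q) x"
    by (subst polymult_expand) (simp add: peval_sum peval_single monomial_fun_add mult_ac)
  finally show ?thesis by simp
qed

lemma polys_zero: "0 \<in> F \<Longrightarrow> 0 \<in> polys F n"
  by (auto simp: polys_def)

lemma polys_single: "0 \<in> F \<Longrightarrow> c \<in> F \<Longrightarrow> Poly_Mapping.keys e \<subseteq> {..<n} \<Longrightarrow> Poly_Mapping.single e c \<in> polys F n"
  by (auto simp: polys_def lookup_single when_def)

lemma polys_add:
  assumes "complex_subfield F" "p \<in> polys F n" "q \<in> polys F n"
  shows "p + q \<in> polys F n"
proof -
  have "Poly_Mapping.lookup p e + Poly_Mapping.lookup q e \<in> F" for e
    by (rule complex_subfieldD(3)[OF assms(1)]) (use assms(2,3) in \<open>auto simp: polys_def\<close>)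
  thus ?thesis
    using assms(2,3) Poly_Mapping.keys_add[of p q] by (force simp: polys_def lookup_add)
qed

lemma polys_sum:
  assumes "complex_subfield F" "\<And>a. a \<in> A \<Longrightarrow> f a \<in> polys F n"
  shows "(\<Sum>a\<in>A. f a) \<in> polys F n"
  using assms(2)
  by (induction A rule: infinite_finite_induct)
    (auto intro: polys_add polys_zero complex_subfieldD assms(1))

lemma polys_mult:
  assumes "complex_subfield F" "p \<in> polys F n" "q \<in> polys F n"
  shows "p * q \<in> polys F n"
proof -
  have "Poly_Mapping.keys (d + e) \<subseteq> {..<n}"
    if "d \<in> Poly_Mapping.keys p" "e \<in> Poly_Mapping.keys q" for d e
    using that assms(2,3) Poly_Mapping.keys_add[of d e] unfolding polys_def by blast
  moreover have "Poly_Mapping.lookup p d \<in> F" "Poly_Mapping.lookup q d \<in> F" for d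
    using assms(2,3) unfolding polys_def by auto
  ultimately show ?thesis
    by (subst polymult_expand) (intro polys_sum polys_single complex_subfieldD assms(1))
qed

text \<open>
  The bridge to polynomials as finitely supported maps: coefficients in \<open>F\<close> are preserved in both
  directions, so every notion defined through \<open>polys\<close> and \<open>peval\<close> can be restated with functions.
\<close>

lemma polyfun_iff_peval:
  assumes "complex_subfield F"
  shows "polyfun F n f \<longleftrightarrow> (\<exists>p\<in>polys F n. f = peval p)"
proof
  assume "polyfun F n f"
  thus "\<exists>p\<in>polys F n. f = peval p"
  proof (induction rule: polyfun.induct)
    case (const c)
    have "(\<lambda>_. c) = peval (Poly_Mapping.single 0 c)"
      by (auto simp: peval_single monomial_fun_def)
    thus ?case using polys_single[of F c 0 n] const complex_subfieldD(1)[OF assms] by auto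
  next
    case (coord i)
    have "(\<lambda>x. x i) = peval (Poly_Mapping.single (Poly_Mapping.single i 1) 1)"
      by (auto simp: peval_single monomial_fun_def)
    thus ?case using polys_single[of F 1 "Poly_Mapping.single i 1" n] coord complex_subfieldD(1,2)[OF assms] by auto
  next
    case (add f g)
    then obtain p q where "p \<in> polys F n" "f = peval p" "q \<in> polys F n" "g = peval q" by blast
    thus ?case using polys_add[OF assms, of p n q] by (intro bexI[of _ "p + q"]) (auto simp: peval_add)
  next
    case (mult f g)
    then obtain p q where "p \<in> polys F n" "f = peval p" "q \<in> polys F n" "g = peval q" by blast
    thus ?case using polys_mult[OF assms, of p n q] by (intro bexI[of _ "p * q"]) (auto simp: peval_mult)
  qed
next
  assume "\<exists>p\<in>polys F n. f = peval p"
  then obtain p where p: "p \<in> polys F n" "f = peval p" by blast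
  have 1: "Poly_Mapping.lookup p e \<in> F" for e using p(1) by (auto simp: polys_def)
  have 2: "i < n" if "e \<in> Poly_Mapping.keys p" "i \<in> Poly_Mapping.keys e" for e i
    using p(1) that by (auto simp: polys_def)
  have "polyfun F n (\<lambda>x. \<Sum>e\<in>Poly_Mapping.keys p. Poly_Mapping.lookup p e *
     (\<Prod>i\<in>Poly_Mapping.keys e. x i ^ Poly_Mapping.lookup e i))"
    by (intro polyfun_intros assms 1 2)
  moreover have "peval p = (\<lambda>x. \<Sum>e\<in>Poly_Mapping.keys p. Poly_Mapping.lookup p e *
     (\<Prod>i\<in>Poly_Mapping.keys e. x i ^ Poly_Mapping.lookup e i))"
    by (simp add: peval_def fun_eq_iff)
  ultimately show "polyfun F n f" using p(2) by simp
qed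

lemma polyfun_peval: "complex_subfield F \<Longrightarrow> p \<in> polys F n \<Longrightarrow> polyfun F n (peval p)"
  using polyfun_iff_peval by blast

lemma algebraic_set_over_iff:
  assumes "complex_subfield F"
  shows "algebraic_set_over F n X \<longleftrightarrow>
    (\<exists>A. finite A \<and> (\<forall>f\<in>A. polyfun F n f) \<and> X = {x\<in>Cn n. \<forall>f\<in>A. f x = 0})"
proof
  assume "algebraic_set_over F n X"
  then obtain P where "finite P" "P \<subseteq> polys F n" "X = zero_set n P"
    by (auto simp: algebraic_set_over_def)
  thus "\<exists>A. finite A \<and> (\<forall>f\<in>A. polyfun F n f) \<and> X = {x\<in>Cn n. \<forall>f\<in>A. f x = 0}"
    by (intro exI[of _ "peval ` P"]) (auto simp: zero_set_def intro: polyfun_peval[OF assms])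
next
  assume "\<exists>A. finite A \<and> (\<forall>f\<in>A. polyfun F n f) \<and> X = {x\<in>Cn n. \<forall>f\<in>A. f x = 0}"
  then obtain A where A: "finite A" "\<forall>f\<in>A. polyfun F n f" "X = {x\<in>Cn n. \<forall>f\<in>A. f x = 0}"
    by blast
  have "A \<subseteq> peval ` polys F n"
    using A(2) polyfun_iff_peval[OF assms] by blast
  with A(1) obtain P where "finite P" "P \<subseteq> polys F n" "A = peval ` P"
    by (metis finite_subset_image)
  thus "algebraic_set_over F n X"
    using A(3) by (auto simp: algebraic_set_over_def zero_set_def intro!: exI[of _ P])
qed

section \<open>The Zariski topology\<close>

lemma zariski_closure_iff:
  "x \<in> zariski_closure n S \<longleftrightarrow>
     x \<in> Cn n \<and> (\<forall>f. polyfun UNIV n f \<longrightarrow> (\<forall>y\<in>S. f y = 0) \<longrightarrow> f x = 0)"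
  unfolding zariski_closure_def zero_set_def vanishing_ideal_def polyfun_iff_peval[OF complex_subfield_UNIV]
  by auto

lemma zariski_closure_subset_Cn: "zariski_closure n S \<subseteq> Cn n"
  by (auto simp: zariski_closure_iff)

lemma subset_zariski_closure: "S \<subseteq> Cn n \<Longrightarrow> S \<subseteq> zariski_closure n S"
  by (auto simp: zariski_closure_iff)

lemma zariski_closure_mono: "S \<subseteq> S' \<Longrightarrow> zariski_closure n S \<subseteq> zariski_closure n S'"
  unfolding subset_iff zariski_closure_iff by blast

lemma zariski_closed_zero_locus:
  assumes "\<forall>f\<in>A. polyfun UNIV n f"
  shows "zariski_closed n {x\<in>Cn n. \<forall>f\<in>A. f x = 0}"
proof -
  let ?P = "{p \<in> polys UNIV n. peval p \<in> A}"
  have "peval ` ?P = A"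
    using assms polyfun_iff_peval[OF complex_subfield_UNIV, of n] by auto
  hence "{x\<in>Cn n. \<forall>f\<in>A. f x = 0} = zero_set n ?P"
    unfolding zero_set_def by (metis (mono_tags, lifting) image_iff)
  moreover have "?P \<subseteq> polys UNIV n" by blast
  ultimately show ?thesis unfolding zariski_closed_def by blast
qed

lemma zariski_closed_closure [simp]: "zariski_closed n (zariski_closure n S)"
  unfolding zariski_closed_def zariski_closure_def
  by (rule exI[of _ "vanishing_ideal n S"]) (auto simp: vanishing_ideal_def)

lemma zariski_closed_iff:
  "zariski_closed n Z \<longleftrightarrow> zariski_closure n Z = Z"
proof
  assume "zariski_closed n Z"
  then obtain P where P: "P \<subseteq> polys UNIV n" "Z = zero_set n P" by (auto simp: zariski_closed_def)
  show "zariski_closure n Z = Z"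
  proof
    show "zariski_closure n Z \<subseteq> Z"
    proof
      fix x assume x: "x \<in> zariski_closure n Z"
      have "peval p x = 0" if "p \<in> P" for p
      proof -
        have "polyfun UNIV n (peval p)" "\<forall>y\<in>Z. peval p y = 0"
          using that P by (auto simp: zero_set_def intro: polyfun_peval)
        thus ?thesis using x unfolding zariski_closure_iff by blast
      qed
      thus "x \<in> Z" using x P(2) by (simp add: zariski_closure_iff zero_set_def)
    qed
    show "Z \<subseteq> zariski_closure n Z"
      by (rule subset_zariski_closure) (auto simp: P zero_set_def)
  qed
next
  assume "zariski_closure n Z = Z"
  thus "zariski_closed n Z"
    using zariski_closed_closure[of n Z] by simp
qed

lemma zariski_closed_subset_Cn: "zariski_closed n Z \<Longrightarrow> Z \<subseteq> Cn n"
  using zariski_closed_iff zariski_closure_subset_Cn by metis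

lemma zariski_closure_minimal:
  "zariski_closed n Z \<Longrightarrow> S \<subseteq> Z \<Longrightarrow> zariski_closure n S \<subseteq> Z"
  using zariski_closure_mono zariski_closed_iff by metis

lemma zariski_closed_Int:
  assumes "zariski_closed n A" "zariski_closed n B"
  shows "zariski_closed n (A \<inter> B)"
  unfolding zariski_closed_iff
proof
  show "A \<inter> B \<subseteq> zariski_closure n (A \<inter> B)"
    using assms by (intro subset_zariski_closure) (auto dest: zariski_closed_subset_Cn)
  show "zariski_closure n (A \<inter> B) \<subseteq> A \<inter> B"
    using zariski_closure_minimal[OF assms(1), of "A \<inter> B"]
      zariski_closure_minimal[OF assms(2), of "A \<inter> B"] by blast
qed

lemma zariski_closed_Un:
  assumes "zariski_closed n A" "zariski_closed n B"
  shows "zariski_closed n (A \<union> B)"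
  unfolding zariski_closed_iff
proof
  show "A \<union> B \<subseteq> zariski_closure n (A \<union> B)"
    using assms by (intro subset_zariski_closure) (auto dest: zariski_closed_subset_Cn)
  show "zariski_closure n (A \<union> B) \<subseteq> A \<union> B"
  proof
    fix x assume x: "x \<in> zariski_closure n (A \<union> B)"
    show "x \<in> A \<union> B"
    proof (rule ccontr)
      assume "x \<notin> A \<union> B"
      moreover have "x \<in> Cn n" using x by (simp add: zariski_closure_iff)
      ultimately obtain f g where f: "polyfun UNIV n f" "\<forall>y\<in>A. f y = 0" "f x \<noteq> 0"
        and g: "polyfun UNIV n g" "\<forall>y\<in>B. g y = 0" "g x \<noteq> 0"
        using zariski_closure_iff[of x n A] zariski_closure_iff[of x n B]
          assms[unfolded zariski_closed_iff] by auto
      have "\<forall>y\<in>A \<union> B. f y * g y = 0" using f(2) g(2) by auto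
      hence "f x * g x = 0"
        using x polyfun.mult[OF f(1) g(1)] unfolding zariski_closure_iff by blast
      with f(3) g(3) show False by simp
    qed
  qed
qed

lemma zariski_closed_singleton:
  assumes "x \<in> Cn n"
  shows "zariski_closed n {x}"
proof -
  have "{x} = {y\<in>Cn n. \<forall>f\<in>(\<lambda>i y. y i - x i) ` {..<n}. f y = 0}"
    using assms by (auto simp: Cn_def fun_eq_iff) (metis lessThan_iff not_le)
  moreover have "zariski_closed n {y\<in>Cn n. \<forall>f\<in>(\<lambda>i y. y i - x i) ` {..<n}. f y = 0}"
    by (rule zariski_closed_zero_locus) (auto intro!: polyfun_intros)
  ultimately show ?thesis by simp
qed

lemma zariski_closed_finite:
  assumes "finite S" "S \<subseteq> Cn n"
  shows "zariski_closed n S"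
  using assms
proof (induction S rule: finite_induct)
  case empty
  have "{} = {x\<in>Cn n. \<forall>f\<in>{\<lambda>_. 1 :: complex}. f x = 0}" by auto
  moreover have "zariski_closed n {x\<in>Cn n. \<forall>f\<in>{\<lambda>_. 1 :: complex}. f x = 0}"
    by (rule zariski_closed_zero_locus) (auto intro: polyfun_intros)
  ultimately show ?case by simp
next
  case (insert x S)
  thus ?case using zariski_closed_Un[of n "{x}" S] zariski_closed_singleton[of x n] by auto
qed

lemma algebraic_imp_zariski_closed:
  assumes "complex_subfield F" "algebraic_set_over F n X"
  shows "zariski_closed n X"
proof -
  obtain A where A: "\<forall>f\<in>A. polyfun F n f" "X = {x\<in>Cn n. \<forall>f\<in>A. f x = 0}"
    using assms(2) unfolding algebraic_set_over_iff[OF assms(1)] by blast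
  show ?thesis unfolding A(2)
    by (rule zariski_closed_zero_locus) (use A(1) polyfun_UNIV in blast)
qed

text \<open>
  Otherwise \<open>Z\<close> would be the union of two proper closed subsets: the closure of the part where \<open>g\<close>
  does not vanish, and the part where it does.
\<close>

lemma irreducible_dense_open:
  assumes "irreducible_closed n Z" "polyfun UNIV n g" "x \<in> Z" "g x \<noteq> 0"
  shows "zariski_closure n {z\<in>Z. g z \<noteq> 0} = Z"
proof -
  have Z: "zariski_closed n Z" using assms(1) by (simp add: irreducible_closed_def)
  have ZC: "Z \<subseteq> Cn n" using Z by (rule zariski_closed_subset_Cn)
  let ?A = "zariski_closure n {z\<in>Z. g z \<noteq> 0}"
  let ?B = "Z \<inter> {z\<in>Cn n. \<forall>f\<in>{g}. f z = 0}"
  have A: "?A \<subseteq> Z" by (rule zariski_closure_minimal[OF Z]) auto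
  have B: "zariski_closed n ?B"
    by (rule zariski_closed_Int[OF Z zariski_closed_zero_locus]) (use assms in auto)
  have "{z\<in>Z. g z \<noteq> 0} \<subseteq> ?A"
    by (rule subset_zariski_closure) (use ZC in auto)
  hence "Z = ?A \<union> ?B" using A ZC by auto
  hence "Z = ?A \<or> Z = ?B"
    using conjunct2[OF conjunct2[OF assms(1)[unfolded irreducible_closed_def]], rule_format,
        OF conjI[OF zariski_closed_closure conjI[OF B]]] by simp
  moreover have "Z \<noteq> ?B" using assms(3,4) by auto
  ultimately show ?thesis by simp
qed

section \<open>A weak Nullstellensatz\<close>

text \<open>
  Strictly speaking a submodule of the space of all functions, so that the set of all functions
  vanishing on \<open>Z\<close> is an instance.
\<close>

definition poly_ideal :: "nat \<Rightarrow> (cvec \<Rightarrow> complex) set \<Rightarrow> bool" where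
  "poly_ideal n J \<longleftrightarrow> (\<lambda>_. 0) \<in> J \<and> (\<forall>f\<in>J. \<forall>g\<in>J. (\<lambda>x. f x + g x) \<in> J) \<and>
     (\<forall>f\<in>J. \<forall>a. polyfun UNIV n a \<longrightarrow> (\<lambda>x. a x * f x) \<in> J)"

lemma poly_ideal_zero: "poly_ideal n J \<Longrightarrow> (\<lambda>_. 0) \<in> J"
  and poly_ideal_add: "poly_ideal n J \<Longrightarrow> f \<in> J \<Longrightarrow> g \<in> J \<Longrightarrow> (\<lambda>x. f x + g x) \<in> J"
  and poly_ideal_mult: "poly_ideal n J \<Longrightarrow> polyfun UNIV n a \<Longrightarrow> f \<in> J \<Longrightarrow> (\<lambda>x. a x * f x) \<in> J"
  by (auto simp: poly_ideal_def)

lemma poly_ideal_cmult: "poly_ideal n J \<Longrightarrow> f \<in> J \<Longrightarrow> (\<lambda>x. c * f x) \<in> J"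
  using poly_ideal_mult[of n J "\<lambda>_. c" f] by (auto intro: polyfun.intros)

lemma poly_ideal_uminus: "poly_ideal n J \<Longrightarrow> f \<in> J \<Longrightarrow> (\<lambda>x. - f x) \<in> J"
  using poly_ideal_cmult[of n J f "-1"] by simp

lemma poly_ideal_diff: "poly_ideal n J \<Longrightarrow> f \<in> J \<Longrightarrow> g \<in> J \<Longrightarrow> (\<lambda>x. f x - g x) \<in> J"
  using poly_ideal_add[OF _ _ poly_ideal_uminus] by fastforce

lemma poly_ideal_sum:
  assumes "poly_ideal n J" "\<And>a. a \<in> A \<Longrightarrow> f a \<in> J"
  shows "(\<lambda>x. \<Sum>a\<in>A. f a x) \<in> J"
  using assms(2)
  by (induction A rule: infinite_finite_induct)
    (auto intro: poly_ideal_zero[OF assms(1)] poly_ideal_add[OF assms(1)])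

text \<open>
  For an ideal \<open>J\<close>, the ideal generated by \<open>J\<close> and \<open>f\<close>.
\<close>

definition add_generator ::
  "nat \<Rightarrow> (cvec \<Rightarrow> complex) set \<Rightarrow> (cvec \<Rightarrow> complex) \<Rightarrow> (cvec \<Rightarrow> complex) set" where
  "add_generator n J f = {\<lambda>x. j x + a x * f x | j a. j \<in> J \<and> polyfun UNIV n a}"

lemma poly_ideal_add_generator:
  assumes "poly_ideal n J"
  shows "poly_ideal n (add_generator n J f)"
  unfolding poly_ideal_def
proof (intro conjI ballI allI impI)
  show "(\<lambda>_. 0) \<in> add_generator n J f"
    unfolding add_generator_def
    by (rule CollectI, rule exI[of _ "\<lambda>_. 0"], rule exI[of _ "\<lambda>_. 0"])
      (auto intro: poly_ideal_zero[OF assms] polyfun.intros)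
next
  fix g h assume "g \<in> add_generator n J f" "h \<in> add_generator n J f"
  then obtain j a k b where "g = (\<lambda>x. j x + a x * f x)" "j \<in> J" "polyfun UNIV n a"
    "h = (\<lambda>x. k x + b x * f x)" "k \<in> J" "polyfun UNIV n b"
    unfolding add_generator_def by blast
  thus "(\<lambda>x. g x + h x) \<in> add_generator n J f"
    unfolding add_generator_def
    by (intro CollectI exI[of _ "\<lambda>x. j x + k x"] exI[of _ "\<lambda>x. a x + b x"])
      (auto intro: poly_ideal_add[OF assms] polyfun.intros simp: algebra_simps)
next
  fix g b assume "g \<in> add_generator n J f" "polyfun UNIV n b"
  then obtain j a where "g = (\<lambda>x. j x + a x * f x)" "j \<in> J" "polyfun UNIV n a"
    unfolding add_generator_def by blast
  thus "(\<lambda>x. b x * g x) \<in> add_generator n J f"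
    using \<open>polyfun UNIV n b\<close> unfolding add_generator_def
    by (intro CollectI exI[of _ "\<lambda>x. b x * j x"] exI[of _ "\<lambda>x. b x * a x"])
      (auto intro: poly_ideal_mult[OF assms] polyfun.intros simp: algebra_simps)
qed

lemma subset_add_generator: "J \<subseteq> add_generator n J f"
proof
  fix j assume "j \<in> J"
  thus "j \<in> add_generator n J f"
    unfolding add_generator_def
    by (intro CollectI exI[of _ j] exI[of _ "\<lambda>_. 0"]) (auto intro: polyfun.intros)
qed

lemma generator_in_add_generator:
  assumes "poly_ideal n J"
  shows "f \<in> add_generator n J f"
  unfolding add_generator_def
  by (intro CollectI exI[of _ "\<lambda>_. 0"] exI[of _ "\<lambda>_. 1"])
    (auto intro: polyfun.intros poly_ideal_zero[OF assms])

lemma unit_in_add_generatorD: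
  assumes "poly_ideal n J" "(\<lambda>_. 1) \<in> add_generator n J f"
  obtains a where "polyfun UNIV n a" "(\<lambda>x. a x * f x - 1) \<in> J"
proof -
  obtain j a where ja: "(\<lambda>_. 1) = (\<lambda>x. j x + a x * f x)" "j \<in> J" "polyfun UNIV n a"
    using assms(2) unfolding add_generator_def by blast
  have "(\<lambda>x. a x * f x - 1) = (\<lambda>x. - j x)"
    using fun_cong[OF ja(1)] by (auto simp: fun_eq_iff algebra_simps eq_neg_iff_add_eq_0)
  with poly_ideal_uminus[OF assms(1) ja(2)] ja(3) that show thesis by simp
qed

definition fun_scale :: "complex \<Rightarrow> (cvec \<Rightarrow> complex) \<Rightarrow> cvec \<Rightarrow> complex" where
  "fun_scale c f = (\<lambda>x. c * f x)"

interpretation funs: vector_space fun_scale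
  by unfold_locales (auto simp: fun_scale_def fun_eq_iff algebra_simps)

text \<open>
  Monomials indexed by words in the variables instead of exponents. Different words may give the same
  monomial, but there are visibly only countably many, and products are concatenations.
\<close>

definition word_monomial :: "nat list \<Rightarrow> cvec \<Rightarrow> complex" where
  "word_monomial is x = prod_list (map x is)"

lemma span_word_monomial_mult:
  assumes "f \<in> funs.span (range word_monomial)" "g \<in> funs.span (range word_monomial)"
  shows "(\<lambda>x. f x * g x) \<in> funs.span (range word_monomial)"
proof -
  have 1: "(\<lambda>x. f x * word_monomial ks x) \<in> funs.span (range word_monomial)" for ks
    using assms(1)
  proof (induction rule: funs.span_induct_alt)
    case base
    show ?case using funs.span_zero[of "range word_monomial"] by (simp add: zero_fun_def)
  next
    case (step c b f)
    then obtain js where b: "b = word_monomial js" by blast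
    have "(\<lambda>x. (fun_scale c b + f) x * word_monomial ks x)
      = fun_scale c (word_monomial (js @ ks)) + (\<lambda>x. f x * word_monomial ks x)"
      by (auto simp: fun_eq_iff fun_scale_def b word_monomial_def algebra_simps)
    moreover have "fun_scale c (word_monomial (js @ ks)) \<in> funs.span (range word_monomial)"
      by (intro funs.span_scale funs.span_base) auto
    ultimately show ?case using step(2) by (simp add: funs.span_add)
  qed
  show ?thesis using assms(2)
  proof (induction rule: funs.span_induct_alt)
    case base
    show ?case using funs.span_zero[of "range word_monomial"] by (simp add: zero_fun_def)
  next
    case (step c b g)
    then obtain ks where b: "b = word_monomial ks" by blast
    have "(\<lambda>x. f x * (fun_scale c b + g) x)
      = fun_scale c (\<lambda>x. f x * word_monomial ks x) + (\<lambda>x. f x * g x)"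
      by (auto simp: fun_eq_iff fun_scale_def b algebra_simps)
    moreover have "fun_scale c (\<lambda>x. f x * word_monomial ks x) \<in> funs.span (range word_monomial)"
      by (intro funs.span_scale 1)
    ultimately show ?case using step(2) by (simp add: funs.span_add)
  qed
qed

lemma polyfun_in_span_word_monomial:
  "polyfun UNIV n f \<Longrightarrow> f \<in> funs.span (range word_monomial)"
proof (induction rule: polyfun.induct)
  case (const c)
  have "(\<lambda>_. c) = fun_scale c (word_monomial [])"
    by (auto simp: fun_scale_def word_monomial_def)
  thus ?case by (auto intro: funs.span_scale funs.span_base)
next
  case (coord i)
  have "(\<lambda>x. x i) = word_monomial [i]" by (auto simp: word_monomial_def)
  thus ?case by (auto intro: funs.span_base)
next
  case (add f g)
  thus ?case using funs.span_add[of f _ g] by (simp add: plus_fun_def)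
next
  case (mult f g)
  thus ?case using span_word_monomial_mult by blast
qed

text \<open>
  The space of polynomial functions has countable dimension. Each \<open>a c\<close> lies in the span of finitely
  many monomials, and as there are only countably many finite sets of monomials, one of them serves
  infinitely many \<open>c\<close>.
\<close>

lemma uncountable_family_dependent:
  fixes a :: "'c \<Rightarrow> cvec \<Rightarrow> complex"
  assumes "uncountable C" "\<And>c. c \<in> C \<Longrightarrow> polyfun UNIV n (a c)"
  obtains S u where "finite S" "S \<subseteq> C" "\<And>x. (\<Sum>c\<in>S. u c * a c x) = 0" "\<exists>c\<in>S. u c \<noteq> (0::complex)"
proof (cases "inj_on a C")
  case False
  then obtain c d where cd: "c \<in> C" "d \<in> C" "c \<noteq> d" "a c = a d" by (auto simp: inj_on_def)
  show thesis
    by (rule that[of "{c, d}" "\<lambda>e. if e = c then 1 else -1"]) (use cd in auto)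
next
  case True
  have "\<exists>K. finite K \<and> a c \<in> funs.span (word_monomial ` K)" if "c \<in> C" for c
  proof -
    have "a c \<in> funs.span (range word_monomial)"
      by (rule polyfun_in_span_word_monomial[OF assms(2)[OF that]])
    then obtain T r where "finite T" "T \<subseteq> range word_monomial" "a c = (\<Sum>b\<in>T. fun_scale (r b) b)"
      unfolding funs.span_explicit by blast
    hence "a c \<in> funs.span T"
      by (simp only:) (intro funs.span_sum funs.span_scale funs.span_base)
    moreover obtain K where "finite K" "T = word_monomial ` K"
      using \<open>finite T\<close> \<open>T \<subseteq> range word_monomial\<close> by (metis finite_subset_image)
    ultimately show ?thesis by blast
  qed
  then obtain K where K: "\<And>c. c \<in> C \<Longrightarrow> finite (K c)" "\<And>c. c \<in> C \<Longrightarrow> a c \<in> funs.span (word_monomial ` K c)"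
    by metis
  have "\<exists>M\<in>{M. finite M}. uncountable {c\<in>C. K c = M}"
  proof (rule ccontr)
    assume "\<not> ?thesis"
    moreover have "countable {M :: nat list set. finite M}"
      using countable_Collect_finite by auto
    ultimately have "countable (\<Union>M\<in>{M. finite M}. {c\<in>C. K c = M})"
      by (intro countable_UN) auto
    moreover have "C \<subseteq> (\<Union>M\<in>{M. finite M}. {c\<in>C. K c = M})"
      using K(1) by auto
    ultimately show False using assms(1) countable_subset by blast
  qed
  then obtain M where M: "finite M" "uncountable {c\<in>C. K c = M}" by blast
  define D where "D = {c\<in>C. K c = M}"
  have D: "D \<subseteq> C" "infinite D" using M(2) by (auto simp: D_def dest: countable_finite)
  have inj: "inj_on a D" using True D(1) by (rule inj_on_subset)
  have "funs.dependent (a ` D)"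
  proof (rule ccontr)
    assume "funs.independent (a ` D)"
    moreover have "a ` D \<subseteq> funs.span (word_monomial ` M)" using K(2) by (auto simp: D_def)
    ultimately have "finite (a ` D)"
      using funs.independent_span_bound[of "word_monomial ` M" "a ` D"] M(1) by blast
    thus False using D(2) inj finite_imageD by blast
  qed
  then obtain T u where T: "finite T" "T \<subseteq> a ` D" "(\<Sum>v\<in>T. fun_scale (u v) v) = 0" "\<exists>v\<in>T. u v \<noteq> 0"
    unfolding funs.dependent_explicit by blast
  obtain S where S: "finite S" "S \<subseteq> D" "T = a ` S"
    using T(1,2) by (metis finite_subset_image)
  have injS: "inj_on a S" using inj S(2) by (rule inj_on_subset)
  have "(\<Sum>c\<in>S. u (a c) * a c x) = 0" for x
  proof -
    have "(\<Sum>v\<in>T. fun_scale (u v) v) x = (\<Sum>v\<in>T. u v * v x)"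
      using T(1) by (induction T rule: finite_induct) (auto simp: fun_scale_def)
    hence "(\<Sum>v\<in>T. u v * v x) = 0" using T(3) by simp
    thus ?thesis unfolding S(3) using sum.reindex[OF injS, of "\<lambda>v. u v * v x"] by simp
  qed
  moreover have "\<exists>c\<in>S. u (a c) \<noteq> 0" using T(4) S(3) by blast
  ultimately show thesis using that[of S "\<lambda>c. u (a c)"] S D(1) by auto
qed

text \<open>
  Modulo \<open>J\<close>, \<open>a c\<close> is an inverse of \<open>f - c\<close>. Uncountably many inverses satisfy a nontrivial linear
  relation, and multiplying it by the product of the factors \<open>f - c\<close> involved turns it into a
  polynomial equation for \<open>f\<close>.
\<close>

lemma uncountably_many_units_imp_algebraic:
  assumes J: "poly_ideal n J" and f: "polyfun UNIV n f" and C: "uncountable C"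
    and a: "\<And>c. c \<in> C \<Longrightarrow> polyfun UNIV n (a c)"
    and aJ: "\<And>c. c \<in> C \<Longrightarrow> (\<lambda>x. a c x * (f x - c) - 1) \<in> J"
  obtains g :: "complex poly" where "g \<noteq> 0" "(\<lambda>x. poly g (f x)) \<in> J"
proof -
  obtain S u where S: "finite S" "S \<subseteq> C" "\<And>x. (\<Sum>c\<in>S. u c * a c x) = 0" "\<exists>c\<in>S. u c \<noteq> 0"
    using uncountable_family_dependent[of C n a, OF C a] by metis
  \<comment> \<open>The linear relation with its denominators cleared. At a point \<open>c\<close> of \<open>S\<close> only the summand of \<open>c\<close> survives.\<close>
  define g where "g = (\<Sum>c\<in>S. Polynomial.smult (u c) (\<Prod>d\<in>S-{c}. [:-d, 1:]))"
  have pg: "poly g z = (\<Sum>c\<in>S. u c * (\<Prod>d\<in>S-{c}. z - d))" for z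
    by (simp add: g_def poly_sum poly_prod)
  obtain c where c: "c \<in> S" "u c \<noteq> 0" using S(4) by blast
  have "poly g c = (\<Sum>e\<in>S. if e = c then u c * (\<Prod>d\<in>S-{c}. c - d) else 0)"
    unfolding pg
  proof (rule sum.cong[OF refl])
    fix e assume e: "e \<in> S"
    show "u e * (\<Prod>d\<in>S-{e}. c - d) = (if e = c then u c * (\<Prod>d\<in>S-{c}. c - d) else 0)"
      using S(1) c(1) by (auto simp: prod_zero_iff)
  qed
  also have "\<dots> = u c * (\<Prod>d\<in>S-{c}. c - d)" using S(1) c(1) by simp
  also have "\<dots> \<noteq> 0" using c(2) S(1) by (auto simp: prod_zero_iff)
  finally have "g \<noteq> 0" by auto
  moreover have "(\<lambda>x. poly g (f x)) \<in> J"
  proof -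
    have "(\<lambda>x. - (\<Sum>c\<in>S. u c * ((\<Prod>d\<in>S-{c}. f x - d) * (a c x * (f x - c) - 1)))) \<in> J"
      using S(2)
      by (intro poly_ideal_uminus[OF J] poly_ideal_sum[OF J] poly_ideal_cmult[OF J]
          poly_ideal_mult[OF J] aJ polyfun_intros f) auto
    also have "(\<lambda>x. - (\<Sum>c\<in>S. u c * ((\<Prod>d\<in>S-{c}. f x - d) * (a c x * (f x - c) - 1))))
      = (\<lambda>x. poly g (f x))"
    proof
      fix x
      have "(\<Sum>c\<in>S. u c * ((\<Prod>d\<in>S-{c}. f x - d) * (a c x * (f x - c) - 1)))
        = (\<Sum>c\<in>S. (\<Prod>d\<in>S. f x - d) * (u c * a c x) - u c * (\<Prod>d\<in>S-{c}. f x - d))"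
      proof (rule sum.cong[OF refl])
        fix c assume "c \<in> S"
        hence *: "(\<Prod>d\<in>S. f x - d) = (f x - c) * (\<Prod>d\<in>S-{c}. f x - d)"
          using S(1) by (rule prod.remove[rotated])
        show "u c * ((\<Prod>d\<in>S-{c}. f x - d) * (a c x * (f x - c) - 1))
          = (\<Prod>d\<in>S. f x - d) * (u c * a c x) - u c * (\<Prod>d\<in>S-{c}. f x - d)"
          unfolding * by (simp add: algebra_simps)
      qed
      also have "\<dots> = (\<Prod>d\<in>S. f x - d) * (\<Sum>c\<in>S. u c * a c x) - poly g (f x)"
        by (simp add: sum_subtractf sum_distrib_left pg)
      finally show "- (\<Sum>c\<in>S. u c * ((\<Prod>d\<in>S-{c}. f x - d) * (a c x * (f x - c) - 1))) = poly g (f x)"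
        using S(3)[of x] by simp
    qed
    finally show ?thesis .
  qed
  ultimately show thesis by (rule that)
qed

lemma polyfun_poly: "polyfun UNIV n f \<Longrightarrow> polyfun UNIV n (\<lambda>x. poly g (f x))"
proof (induction g)
  case (pCons c g)
  show ?case
    unfolding poly_pCons by (intro polyfun.intros pCons) auto
qed (auto intro: polyfun.intros)

text \<open>
  In geometric terms, \<open>f\<close> takes some value on the zero locus of a proper ideal. If all \<open>f - c\<close> were
  invertible modulo \<open>J\<close>, then \<open>f\<close> would satisfy a polynomial equation modulo \<open>J\<close>; over the complex
  numbers it splits into factors \<open>f - c\<close>, which can be cancelled one by one until \<open>1 \<in> J\<close>.
\<close>

lemma proper_ideal_add_value:
  assumes J: "poly_ideal n J" "(\<lambda>_. 1) \<notin> J" and f: "polyfun UNIV n f"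
  obtains c where "(\<lambda>_. 1) \<notin> add_generator n J (\<lambda>x. f x - c)"
proof (rule ccontr)
  assume "\<not> thesis"
  hence "\<exists>a. polyfun UNIV n a \<and> (\<lambda>x. a x * (f x - c) - 1) \<in> J" for c
    using unit_in_add_generatorD[OF J(1), of "\<lambda>x. f x - c"] that by metis
  then obtain a where a: "\<And>c. polyfun UNIV n (a c)" "\<And>c. (\<lambda>x. a c x * (f x - c) - 1) \<in> J"
    by metis
  have "uncountable (UNIV :: complex set)"
    by (rule uncountable_UNIV_complex)
  then obtain g where g: "g \<noteq> 0" "(\<lambda>x. poly g (f x)) \<in> J"
    using uncountably_many_units_imp_algebraic[OF J(1) f, of UNIV a] a by blast
  thus False
  proof (induction "degree g" arbitrary: g)
    case 0
    then obtain k where k: "g = [:k:]" "k \<noteq> 0" by (metis degree_eq_zeroE pCons_0_0)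
    hence "(\<lambda>x. inverse k * poly g (f x)) \<in> J" using 0 by (intro poly_ideal_cmult[OF J(1)]) auto
    thus False using k J(2) by simp
  next
    case (Suc d)
    obtain c where "poly g c = 0"
      using fundamental_theorem_of_algebra[of g] Suc.hyps(2) constant_degree[of g] by auto
    then obtain q where q: "g = [:-c, 1:] * q" by (auto simp: poly_eq_0_iff_dvd)
    have "q \<noteq> 0" using Suc.prems q by auto
    moreover have "degree q = d" using Suc.hyps(2) \<open>q \<noteq> 0\<close> unfolding q by (subst (asm) degree_mult_eq) auto
    moreover have "(\<lambda>x. poly q (f x)) \<in> J"
    proof -
      have "(\<lambda>x. a c x * poly g (f x) - poly q (f x) * (a c x * (f x - c) - 1)) \<in> J"
        by (intro poly_ideal_diff[OF J(1)] poly_ideal_mult[OF J(1) a(1) Suc.prems(2)]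
            poly_ideal_mult[OF J(1) polyfun_poly[OF f] a(2)])
      thus ?thesis by (simp add: q algebra_simps)
    qed
    ultimately show False using Suc.hyps(1) by blast
  qed
qed

text \<open>
  The values of the coordinates are chosen one after the other, keeping the ideal proper. Modulo the
  final ideal every polynomial is congruent to its value at the chosen point.
\<close>

lemma weak_nullstellensatz:
  assumes J: "poly_ideal n J" "(\<lambda>_. 1) \<notin> J" "\<And>f. f \<in> J \<Longrightarrow> polyfun UNIV n f"
  obtains x where "x \<in> Cn n" "\<And>f. f \<in> J \<Longrightarrow> f x = 0"
proof -
  have "\<exists>J' c. poly_ideal n J' \<and> J \<subseteq> J' \<and> (\<lambda>_. 1) \<notin> J' \<and> (\<forall>i<k. (\<lambda>x. x i - c i) \<in> J')"
    if "k \<le> n" for k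
    using that
  proof (induction k)
    case 0
    thus ?case using J by auto
  next
    case (Suc k)
    then obtain J' c where J': "poly_ideal n J'" "J \<subseteq> J'" "(\<lambda>_. 1) \<notin> J'" "\<forall>i<k. (\<lambda>x. x i - c i) \<in> J'"
      by auto
    obtain z where z: "(\<lambda>_. 1) \<notin> add_generator n J' (\<lambda>x. x k - z)"
      using proper_ideal_add_value[OF J'(1,3) polyfun.coord] Suc.prems by (metis Suc_le_lessD)
    let ?J = "add_generator n J' (\<lambda>x. x k - z)"
    have "(\<lambda>x. x i - (c(k := z)) i) \<in> ?J" if "i < Suc k" for i
      using generator_in_add_generator[OF J'(1), of "\<lambda>x. x k - z"] subset_add_generator[of J'] J'(4) that
      by (cases "i = k") (auto simp: subset_iff)
    thus ?case
      using poly_ideal_add_generator[OF J'(1)] z subset_add_generator[of J'] J'(2) by blast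
  qed
  from this[of n] obtain J' c where J': "poly_ideal n J'" "J \<subseteq> J'" "(\<lambda>_. 1) \<notin> J'"
      "\<forall>i<n. (\<lambda>x. x i - c i) \<in> J'" by blast
  define z where "z = (\<lambda>i. if i < n then c i else 0)"
  have cong: "(\<lambda>x. f x - f z) \<in> J'" if "polyfun UNIV n f" for f
    using that
  proof (induction rule: polyfun.induct)
    case (const c)
    thus ?case using poly_ideal_zero[OF J'(1)] by simp
  next
    case (coord i)
    thus ?case using J'(4) by (auto simp: z_def)
  next
    case (add f g)
    have "(\<lambda>x. (f x - f z) + (g x - g z)) \<in> J'"
      by (rule poly_ideal_add[OF J'(1) add.IH])
    thus ?case by (simp add: algebra_simps)
  next
    case (mult f g)
    have "(\<lambda>x. g x * (f x - f z) + f z * (g x - g z)) \<in> J'"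
      by (intro poly_ideal_add[OF J'(1)] poly_ideal_mult[OF J'(1)] poly_ideal_cmult[OF J'(1)] mult)
    thus ?case by (simp add: algebra_simps)
  qed
  show thesis
  proof (rule that[of z])
    show "z \<in> Cn n" by (auto simp: z_def Cn_def)
    fix f assume f: "f \<in> J"
    have "(\<lambda>x. f x - (f x - f z)) \<in> J'"
      by (rule poly_ideal_diff[OF J'(1) _ cong[OF J(3)[OF f]]]) (use f J'(2) in auto)
    hence "(\<lambda>x. inverse (f z) * f z) \<in> J'"
      using poly_ideal_cmult[OF J'(1), of "\<lambda>_. f z" "inverse (f z)"] by simp
    thus "f z = 0" using J'(3) by (cases "f z = 0") auto
  qed
qed

text \<open>
  The ideal generated by \<open>f\<close> and the polynomials vanishing on \<open>Z\<close> has no common zero.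
\<close>

lemma nonvanishing_imp_invertible:
  assumes Z: "zariski_closed n Z" and f: "polyfun UNIV n f" "\<And>x. x \<in> Z \<Longrightarrow> f x \<noteq> 0"
  obtains a where "polyfun UNIV n a" "\<And>x. x \<in> Z \<Longrightarrow> a x * f x = 1"
proof -
  let ?I = "{h. polyfun UNIV n h \<and> (\<forall>x\<in>Z. h x = 0)}"
  have I: "poly_ideal n ?I" by (auto simp: poly_ideal_def intro: polyfun.intros)
  let ?J = "add_generator n ?I f"
  have J: "poly_ideal n ?J" by (rule poly_ideal_add_generator[OF I])
  have "(\<lambda>_. 1) \<in> ?J"
  proof (rule ccontr)
    assume "(\<lambda>_. 1) \<notin> ?J"
    moreover have "polyfun UNIV n h" if "h \<in> ?J" for h
      using that f(1) unfolding add_generator_def by (auto intro: polyfun.intros)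
    ultimately obtain x where x: "x \<in> Cn n" "\<And>h. h \<in> ?J \<Longrightarrow> h x = 0"
      using weak_nullstellensatz[OF J, of thesis] by blast
    have "x \<in> zariski_closure n Z"
      using x subset_add_generator[of ?I n f] by (auto simp: zariski_closure_iff)
    hence "x \<in> Z" using Z by (simp add: zariski_closed_iff)
    moreover have "f x = 0" by (rule x(2)[OF generator_in_add_generator[OF I]])
    ultimately show False using f(2) by blast
  qed
  then obtain a where "polyfun UNIV n a" "(\<lambda>x. a x * f x - 1) \<in> ?I"
    by (rule unit_in_add_generatorD[OF I])
  thus thesis using that by auto
qed

text \<open>
  If a coordinate is real on \<open>Z\<close>, then \<open>x i - c\<close> is invertible on \<open>Z\<close> for each of the uncountably many
  nonreal \<open>c\<close>. Hence the coordinate satisfies a polynomial equation on \<open>Z\<close> and takes only finitely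
  many values.
\<close>

lemma zariski_closed_real_imp_finite:
  assumes Z: "zariski_closed n Z" and real: "\<And>x. x \<in> Z \<Longrightarrow> conj_map x = x"
  shows "finite Z"
proof -
  have "\<exists>R. finite R \<and> (\<forall>x\<in>Z. x i \<in> R)" if i: "i < n" for i
  proof -
    let ?C = "range (\<lambda>t. Complex t 1)"
    have "inj (\<lambda>t. Complex t 1)" by (auto simp: inj_on_def)
    hence C: "uncountable ?C"
      using countable_image_inj_on[of "\<lambda>t. Complex t 1" UNIV] uncountable_UNIV_real by blast
    have coord: "polyfun UNIV n (\<lambda>x. x i)" using i by (rule polyfun.coord)
    have "\<exists>a. polyfun UNIV n a \<and> (\<forall>x\<in>Z. a x * (x i - c) = 1)" if c: "c \<in> ?C" for c
    proof -
      have nz: "x i - c \<noteq> 0" if "x \<in> Z" for x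
      proof -
        have "cnj (x i) = x i" using fun_cong[OF real[OF that], of i] by (simp add: conj_map_def)
        hence "Im (x i) = 0" by (metis Im_complex_of_real cnj.sel(2) complex_cnj_complex_of_real neg_equal_zero)
        thus ?thesis using c by auto
      qed
      have "polyfun UNIV n (\<lambda>x. x i - c)"
        by (intro polyfun_intros i) auto
      then obtain b where "polyfun UNIV n b" "\<And>x. x \<in> Z \<Longrightarrow> b x * (x i - c) = 1"
        using nonvanishing_imp_invertible[of n Z "\<lambda>x. x i - c"] Z nz by blast
      thus ?thesis by blast
    qed
    then obtain a where a: "\<And>c. c \<in> ?C \<Longrightarrow> polyfun UNIV n (a c)"
      "\<And>c x. c \<in> ?C \<Longrightarrow> x \<in> Z \<Longrightarrow> a c x * (x i - c) = 1" by metis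
    let ?I = "{h. \<forall>x\<in>Z. h x = (0 :: complex)}"
    have I: "poly_ideal n ?I" by (auto simp: poly_ideal_def)
    obtain g :: "complex poly" where g: "g \<noteq> 0" "(\<lambda>x. poly g (x i)) \<in> ?I"
      using uncountably_many_units_imp_algebraic[OF I coord C, of a] a by auto
    show ?thesis
      using g poly_roots_finite[of g] by (intro exI[of _ "{z. poly g z = 0}"]) auto
  qed
  then obtain R where R: "\<And>i. i < n \<Longrightarrow> finite (R i)" "\<And>i x. i < n \<Longrightarrow> x \<in> Z \<Longrightarrow> x i \<in> R i"
    by metis
  have "inj_on (\<lambda>x. restrict x {..<n}) Z"
  proof (rule inj_onI)
    fix x y assume xy: "x \<in> Z" "y \<in> Z" "restrict x {..<n} = restrict y {..<n}"
    show "x = y"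
    proof
      fix i
      show "x i = y i"
      proof (cases "i < n")
        case True
        thus ?thesis using fun_cong[OF xy(3), of i] by simp
      next
        case False
        have "x \<in> Cn n" "y \<in> Cn n" using xy(1,2) zariski_closed_subset_Cn[OF Z] by auto
        thus ?thesis using False by (simp add: Cn_def)
      qed
    qed
  qed
  moreover have "(\<lambda>x. restrict x {..<n}) ` Z \<subseteq> Pi\<^sub>E {..<n} R"
    by (rule image_subsetI, rule PiE_I) (use R(2) in auto)
  moreover have "finite (Pi\<^sub>E {..<n} R)"
    using R(1) by (intro finite_PiE) auto
  ultimately show ?thesis by (metis finite_imageD finite_subset)
qed

section \<open>Derivatives and tangent spaces\<close>

definition partial_deriv :: "nat \<Rightarrow> (cvec \<Rightarrow> complex) \<Rightarrow> cvec \<Rightarrow> complex" where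
  "partial_deriv i f x = deriv (\<lambda>t. f (x(i := t))) (x i)"

definition dirderiv :: "nat \<Rightarrow> (cvec \<Rightarrow> complex) \<Rightarrow> cvec \<Rightarrow> cvec \<Rightarrow> complex" where
  "dirderiv n f x v = (\<Sum>i<n. partial_deriv i f x * v i)"

lemma dirderiv_add: "dirderiv n f x (v + w) = dirderiv n f x v + dirderiv n f x w"
  by (simp add: dirderiv_def algebra_simps sum.distrib)

lemma dirderiv_scale: "dirderiv n f x (cscale c v) = c * dirderiv n f x v"
  by (simp add: dirderiv_def cscale_def sum_distrib_left mult_ac)

text \<open>
  Along a curve only one-variable derivatives occur. This suffices for differentiating rational
  maps, which are defined near a point only, by restricting them to lines.
\<close>

lemma polyfun_chain_rule:
  assumes f: "polyfun UNIV n f"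
    and \<gamma>: "\<And>i. i < n \<Longrightarrow> ((\<lambda>t. \<gamma> t i) has_field_derivative v i) (at t0)"
  shows "((\<lambda>t. f (\<gamma> t)) has_field_derivative dirderiv n f (\<gamma> t0) v) (at t0)"
proof -
  have "\<exists>c. \<forall>\<gamma> v t0. \<gamma> t0 = x \<longrightarrow> (\<forall>i<n. ((\<lambda>t. \<gamma> t i) has_field_derivative v i) (at t0)) \<longrightarrow>
      ((\<lambda>t. f (\<gamma> t)) has_field_derivative (\<Sum>i<n. c i * v i)) (at t0)" for x
    using f
  proof (induction rule: polyfun.induct)
    case (const c)
    show ?case by (rule exI[of _ "\<lambda>_. 0"]) auto
  next
    case (coord i)
    have "(\<Sum>j<n. (if j = i then 1 else 0) * v j) = v i" for v :: cvec
    proof -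
      have "(\<Sum>j<n. (if j = i then 1 else 0) * v j) = (\<Sum>j<n. if j = i then v j else 0)"
        by (rule sum.cong) auto
      thus ?thesis using coord by simp
    qed
    thus ?case using coord by (intro exI[of _ "\<lambda>j. if j = i then 1 else 0"]) auto
  next
    case (add f g)
    obtain c where c: "\<And>\<gamma> v t0. \<gamma> t0 = x \<Longrightarrow> (\<forall>i<n. ((\<lambda>t. \<gamma> t i) has_field_derivative v i) (at t0)) \<Longrightarrow>
      ((\<lambda>t. f (\<gamma> t)) has_field_derivative (\<Sum>i<n. c i * v i)) (at t0)"
      using add.IH(1) by blast
    obtain d where d: "\<And>\<gamma> v t0. \<gamma> t0 = x \<Longrightarrow> (\<forall>i<n. ((\<lambda>t. \<gamma> t i) has_field_derivative v i) (at t0)) \<Longrightarrow>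
      ((\<lambda>t. g (\<gamma> t)) has_field_derivative (\<Sum>i<n. d i * v i)) (at t0)"
      using add.IH(2) by blast
    have e: "(\<Sum>i<n. (c i + d i) * v i) = (\<Sum>i<n. c i * v i) + (\<Sum>i<n. d i * v i)" for v
      by (simp add: algebra_simps sum.distrib)
    show ?case
      by (intro exI[of _ "\<lambda>i. c i + d i"] allI impI, unfold e, intro DERIV_add c d; assumption)
  next
    case (mult f g)
    obtain c where c: "\<And>\<gamma> v t0. \<gamma> t0 = x \<Longrightarrow> (\<forall>i<n. ((\<lambda>t. \<gamma> t i) has_field_derivative v i) (at t0)) \<Longrightarrow>
      ((\<lambda>t. f (\<gamma> t)) has_field_derivative (\<Sum>i<n. c i * v i)) (at t0)"
      using mult.IH(1) by blast
    obtain d where d: "\<And>\<gamma> v t0. \<gamma> t0 = x \<Longrightarrow> (\<forall>i<n. ((\<lambda>t. \<gamma> t i) has_field_derivative v i) (at t0)) \<Longrightarrow>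
      ((\<lambda>t. g (\<gamma> t)) has_field_derivative (\<Sum>i<n. d i * v i)) (at t0)"
      using mult.IH(2) by blast
    have e: "(\<Sum>i<n. (c i * g x + d i * f x) * v i)
        = (\<Sum>i<n. c i * v i) * g x + (\<Sum>i<n. d i * v i) * f x" for v
      by (simp add: algebra_simps sum.distrib sum_distrib_left)
    show ?case
    proof (intro exI[of _ "\<lambda>i. c i * g x + d i * f x"] allI impI)
      fix \<gamma> :: "complex \<Rightarrow> cvec" and v t0
      assume *: "\<gamma> t0 = x" "\<forall>i<n. ((\<lambda>t. \<gamma> t i) has_field_derivative v i) (at t0)"
      show "((\<lambda>t. f (\<gamma> t) * g (\<gamma> t)) has_field_derivative
          (\<Sum>i<n. (c i * g x + d i * f x) * v i)) (at t0)"
        using DERIV_mult[OF c[OF *] d[OF *]] *(1) unfolding e by simp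
    qed
  qed
  from this[of "\<gamma> t0"] obtain c where c: "\<And>\<gamma>' v' t1. \<gamma>' t1 = \<gamma> t0 \<Longrightarrow>
      (\<forall>i<n. ((\<lambda>t. \<gamma>' t i) has_field_derivative v' i) (at t1)) \<Longrightarrow>
      ((\<lambda>t. f (\<gamma>' t)) has_field_derivative (\<Sum>i<n. c i * v' i)) (at t1)" by blast
  have "partial_deriv i f (\<gamma> t0) = c i" if "i < n" for i
  proof -
    let ?x = "\<gamma> t0"
    have "((\<lambda>t. f (?x(i := t))) has_field_derivative
        (\<Sum>j<n. c j * (if j = i then 1 else 0))) (at (?x i))"
    proof (rule c)
      show "\<forall>j<n. ((\<lambda>t. (?x(i := t)) j) has_field_derivative (if j = i then 1 else 0)) (at (?x i))"
        by (auto intro!: derivative_eq_intros)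
    qed simp
    also have "(\<Sum>j<n. c j * (if j = i then 1 else 0)) = (\<Sum>j<n. if j = i then c j else 0)"
      by (rule sum.cong) auto
    also have "\<dots> = c i"
      using that by simp
    finally show ?thesis unfolding partial_deriv_def by (rule DERIV_imp_deriv)
  qed
  hence "dirderiv n f (\<gamma> t0) v = (\<Sum>i<n. c i * v i)" by (simp add: dirderiv_def)
  thus ?thesis using c[of \<gamma> t0 v] \<gamma> by simp
qed

lemma tangent_space_iff:
  "v \<in> tangent_space n X x \<longleftrightarrow> v \<in> Cn n \<and>
     (\<forall>f. polyfun UNIV n f \<longrightarrow> (\<forall>y\<in>X. f y = 0) \<longrightarrow> dirderiv n f x v = 0)"
  unfolding tangent_space_def vanishing_ideal_def polyfun_iff_peval[OF complex_subfield_UNIV]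
    dirderiv_def partial_deriv_def partial_at_def by auto

lemma subspace_tangent_space: "cvec.subspace (tangent_space n X x)"
  unfolding cvec.subspace_def
  by (auto simp: tangent_space_iff dirderiv_add dirderiv_scale Cn_def dirderiv_def[of _ _ _ 0])
    (auto simp: cscale_def)

lemma has_derivative_on_line:
  "((\<lambda>t. x i + t * v i) has_field_derivative v i) (at (0 :: complex))"
  by (auto intro!: derivative_eq_intros)

lemma polyfun_derivative_on_line:
  assumes "polyfun UNIV n f"
  shows "((\<lambda>t. f (\<lambda>i. x i + t * v i)) has_field_derivative dirderiv n f x v) (at 0)"
  using polyfun_chain_rule[OF assms, of "\<lambda>t i. x i + t * v i" v 0]
    has_derivative_on_line[of x _ v] by simp

text \<open>
  The space of all sequences is infinite-dimensional, so the comparison goes through a basis of \<open>S\<close>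
  and its image.
\<close>

lemma cvec_dim_eq_if_mutually_inverse:
  assumes D: "Vector_Spaces.linear cscale cscale D"
    and S: "cvec.subspace S" and DS: "D ` S \<subseteq> T" and ET: "E ` T \<subseteq> S"
    and ED: "\<And>v. v \<in> S \<Longrightarrow> E (D v) = v" and DE: "\<And>w. w \<in> T \<Longrightarrow> D (E w) = w"
  shows "cvec.dim S = cvec.dim T"
proof -
  interpret D: Vector_Spaces.linear cscale cscale D by (rule D)
  obtain B where B: "B \<subseteq> S" "cvec.independent B" "S \<subseteq> cvec.span B" "card B = cvec.dim S"
    using cvec.basis_exists by blast
  have span: "cvec.span B = S" using B S cvec.span_minimal by blast
  have inj: "inj_on D S" using ED by (intro inj_on_inverseI[of S E])
  have "cvec.independent (D ` B)"
    by (rule D.independent_injective_image[OF B(2)]) (simp add: span inj)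
  moreover have "T \<subseteq> cvec.span (D ` B)"
  proof
    fix w assume "w \<in> T"
    hence "w = D (E w)" "E w \<in> cvec.span B" using DE ET span by auto
    thus "w \<in> cvec.span (D ` B)" unfolding D.span_image by (metis imageI)
  qed
  moreover have "D ` B \<subseteq> T" using B(1) DS by blast
  moreover have "card (D ` B) = card B" using inj B(1) by (metis card_image inj_on_subset)
  ultimately show ?thesis using cvec.basis_card_eq_dim B(4) by metis
qed

section \<open>Principal open subsets as closed varieties\<close>

definition fraction_map :: "nat \<Rightarrow> (nat \<Rightarrow> cvec \<Rightarrow> complex) \<Rightarrow> (cvec \<Rightarrow> complex) \<Rightarrow> cvec \<Rightarrow> cvec" where
  "fraction_map m a g x = (\<lambda>j. if j < m then a j x / g x else 0)"

definition tuple_map :: "nat \<Rightarrow> (nat \<Rightarrow> cvec \<Rightarrow> complex) \<Rightarrow> cvec \<Rightarrow> cvec" where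
  "tuple_map n s y = (\<lambda>i. if i < n then s i y else 0)"

text \<open>
  \<open>\<Phi>\<close> identifies the principal open subset \<open>g \<noteq> 0\<close> of \<open>X\<close> with the closed set \<open>Y\<close>, and the polynomial map
  \<open>\<pi>\<close> is its inverse.
\<close>

locale principal_open_chart =
  fixes n m :: nat and X Y :: "cvec set" and g :: "cvec \<Rightarrow> complex"
    and a s :: "nat \<Rightarrow> cvec \<Rightarrow> complex" and \<Phi> \<pi> :: "cvec \<Rightarrow> cvec"
  defines "\<Phi> \<equiv> fraction_map m a g" and "\<pi> \<equiv> tuple_map n s"
  assumes X: "zariski_closed n X" and Y: "zariski_closed m Y"
    and g: "polyfun UNIV n g"
    and a: "\<And>j. j < m \<Longrightarrow> polyfun UNIV n (a j)"
    and s: "\<And>i. i < n \<Longrightarrow> polyfun UNIV m (s i)"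
    and \<Phi>_in: "\<And>x. x \<in> X \<Longrightarrow> g x \<noteq> 0 \<Longrightarrow> \<Phi> x \<in> Y"
    and \<pi>_in: "\<And>y. y \<in> Y \<Longrightarrow> \<pi> y \<in> X" "\<And>y. y \<in> Y \<Longrightarrow> g (\<pi> y) \<noteq> 0"
    and \<pi>_\<Phi>: "\<And>x. x \<in> X \<Longrightarrow> g x \<noteq> 0 \<Longrightarrow> \<pi> (\<Phi> x) = x"
    and \<Phi>_\<pi>: "\<And>y. y \<in> Y \<Longrightarrow> \<Phi> (\<pi> y) = y"
begin

lemma YC: "Y \<subseteq> Cn m" using Y by (rule zariski_closed_subset_Cn)

lemma \<Phi>_Cn: "\<Phi> x \<in> Cn m" by (simp add: \<Phi>_def fraction_map_def Cn_def)

lemma \<pi>_Cn: "\<pi> y \<in> Cn n" by (simp add: \<pi>_def tuple_map_def Cn_def)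

lemma polyfun_comp_\<pi>: "polyfun UNIV n f \<Longrightarrow> polyfun UNIV m (\<lambda>y. f (\<pi> y))"
  by (rule polyfun_compose) (auto simp: \<pi>_def tuple_map_def intro: s)

text \<open>
  Pulled back along \<open>\<Phi>\<close>, a polynomial becomes a fraction with a power of \<open>g\<close> as denominator.
\<close>

lemma clear_denominators:
  assumes "polyfun UNIV m q"
  obtains b N where "polyfun UNIV n b" "\<And>x. g x \<noteq> 0 \<Longrightarrow> q (\<Phi> x) = b x / g x ^ N"
proof -
  have "\<exists>b N. polyfun UNIV n b \<and> (\<forall>x. g x \<noteq> 0 \<longrightarrow> q (\<Phi> x) = b x / g x ^ N)"
    using assms
  proof (induction rule: polyfun.induct)
    case (const c)
    thus ?case by (intro exI[of _ "\<lambda>_. c"] exI[of _ 0]) (auto intro: polyfun.intros)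
  next
    case (coord j)
    thus ?case by (intro exI[of _ "a j"] exI[of _ 1]) (auto intro: a simp: \<Phi>_def fraction_map_def)
  next
    case (add p q)
    then obtain b N c M where "polyfun UNIV n b" "\<And>x. g x \<noteq> 0 \<Longrightarrow> p (\<Phi> x) = b x / g x ^ N"
      "polyfun UNIV n c" "\<And>x. g x \<noteq> 0 \<Longrightarrow> q (\<Phi> x) = c x / g x ^ M" by metis
    thus ?case
      by (intro exI[of _ "\<lambda>x. b x * g x ^ M + c x * g x ^ N"] exI[of _ "N + M"])
        (auto intro!: polyfun.add polyfun.mult polyfun_power g simp: power_add field_simps)
  next
    case (mult p q)
    then obtain b N c M where "polyfun UNIV n b" "\<And>x. g x \<noteq> 0 \<Longrightarrow> p (\<Phi> x) = b x / g x ^ N"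
      "polyfun UNIV n c" "\<And>x. g x \<noteq> 0 \<Longrightarrow> q (\<Phi> x) = c x / g x ^ M" by metis
    thus ?case
      by (intro exI[of _ "\<lambda>x. b x * c x"] exI[of _ "N + M"])
        (auto intro!: polyfun.mult simp: power_add)
  qed
  thus thesis using that by blast
qed

text \<open>
  \<open>\<Phi>\<close> is continuous for the Zariski topology, since the numerator of the pullback of an equation of
  \<open>A\<close> vanishes on \<open>\<pi> ` A\<close> and therefore on its closure.
\<close>

lemma \<Phi>_in_closed:
  assumes "zariski_closed m A" "A \<subseteq> Y" "x \<in> zariski_closure n (\<pi> ` A)" "g x \<noteq> 0"
  shows "\<Phi> x \<in> A"
proof -
  have "q (\<Phi> x) = 0" if q: "polyfun UNIV m q" "\<forall>y\<in>A. q y = 0" for q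
  proof -
    obtain b N where b: "polyfun UNIV n b" "\<And>x. g x \<noteq> 0 \<Longrightarrow> q (\<Phi> x) = b x / g x ^ N"
      using clear_denominators[OF q(1)] by blast
    have "b (\<pi> y) = 0" if "y \<in> A" for y
      using b(2)[of "\<pi> y"] q(2) that assms(2) \<pi>_in(2)[of y] \<Phi>_\<pi>[of y] by auto
    hence "b x = 0" using assms(3) b(1) by (auto simp: zariski_closure_iff)
    thus ?thesis using b(2)[OF assms(4)] by simp
  qed
  hence "\<Phi> x \<in> zariski_closure m A" by (auto simp: zariski_closure_iff \<Phi>_Cn)
  thus ?thesis using assms(1) by (simp add: zariski_closed_iff)
qed

text \<open>
  The next two operations are inverse bijections between the irreducible closed subsets of \<open>X\<close> that meet
  the open subset and the irreducible closed subsets of \<open>Y\<close>. The local dimension is defined by chains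
  of such sets, so it can be transported along them.
\<close>

definition restrict_open :: "cvec set \<Rightarrow> cvec set" where
  "restrict_open Z = {y\<in>Y. \<pi> y \<in> Z}"

definition close_up :: "cvec set \<Rightarrow> cvec set" where
  "close_up W = zariski_closure n (\<pi> ` W)"

lemma restrict_open_closed:
  assumes "zariski_closed n Z"
  shows "zariski_closed m (restrict_open Z)"
  unfolding zariski_closed_iff
proof
  have sub: "restrict_open Z \<subseteq> Y" by (auto simp: restrict_open_def)
  show "restrict_open Z \<subseteq> zariski_closure m (restrict_open Z)"
    using YC sub by (intro subset_zariski_closure) auto
  show "zariski_closure m (restrict_open Z) \<subseteq> restrict_open Z"
  proof
    fix y assume y: "y \<in> zariski_closure m (restrict_open Z)"
    have "f (\<pi> y) = 0" if f: "polyfun UNIV n f" "\<forall>z\<in>Z. f z = 0" for f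
      using y polyfun_comp_\<pi>[OF f(1)] f(2) by (auto simp: zariski_closure_iff restrict_open_def)
    hence "\<pi> y \<in> zariski_closure n Z" by (auto simp: zariski_closure_iff \<pi>_Cn)
    moreover have "y \<in> Y" using zariski_closure_minimal[OF Y sub] y by blast
    ultimately show "y \<in> restrict_open Z"
      using assms by (simp add: zariski_closed_iff restrict_open_def)
  qed
qed

lemma \<pi>_restrict_open:
  assumes "Z \<subseteq> X"
  shows "\<pi> ` restrict_open Z = {z\<in>Z. g z \<noteq> 0}"
proof
  show "\<pi> ` restrict_open Z \<subseteq> {z\<in>Z. g z \<noteq> 0}" using \<pi>_in by (auto simp: restrict_open_def)
  show "{z\<in>Z. g z \<noteq> 0} \<subseteq> \<pi> ` restrict_open Z"
  proof
    fix z assume z: "z \<in> {z\<in>Z. g z \<noteq> 0}"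
    hence "\<Phi> z \<in> restrict_open Z" "z = \<pi> (\<Phi> z)"
      using assms \<Phi>_in \<pi>_\<Phi> by (auto simp: restrict_open_def)
    thus "z \<in> \<pi> ` restrict_open Z" by blast
  qed
qed

lemma close_up_restrict_open:
  assumes "irreducible_closed n Z" "Z \<subseteq> X" "x \<in> Z" "g x \<noteq> 0"
  shows "close_up (restrict_open Z) = Z"
  unfolding close_up_def \<pi>_restrict_open[OF assms(2)]
  by (rule irreducible_dense_open[OF assms(1) g assms(3,4)])

lemma restrict_open_close_up:
  assumes "zariski_closed m W" "W \<subseteq> Y"
  shows "restrict_open (close_up W) = W"
proof
  show "restrict_open (close_up W) \<subseteq> W"
  proof
    fix y assume "y \<in> restrict_open (close_up W)"
    hence "y \<in> Y" "\<pi> y \<in> zariski_closure n (\<pi> ` W)" by (auto simp: restrict_open_def close_up_def)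
    thus "y \<in> W" using \<Phi>_in_closed[OF assms, of "\<pi> y"] \<pi>_in(2) \<Phi>_\<pi> by simp
  qed
  have "\<pi> ` W \<subseteq> zariski_closure n (\<pi> ` W)"
    by (rule subset_zariski_closure) (auto simp: \<pi>_Cn)
  thus "W \<subseteq> restrict_open (close_up W)"
    using assms(2) by (auto simp: restrict_open_def close_up_def)
qed

lemma restrict_open_irreducible:
  assumes Z: "irreducible_closed n Z" and "Z \<subseteq> X" "x \<in> Z" "g x \<noteq> 0"
  shows "irreducible_closed m (restrict_open Z)"
  unfolding irreducible_closed_def
proof (intro conjI allI impI)
  have Zc: "zariski_closed n Z" using Z by (simp add: irreducible_closed_def)
  show "zariski_closed m (restrict_open Z)" by (rule restrict_open_closed[OF Zc])
  have "\<Phi> x \<in> restrict_open Z"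
    using assms(2-4) \<Phi>_in[of x] \<pi>_\<Phi>[of x] by (auto simp: restrict_open_def)
  thus "restrict_open Z \<noteq> {}" by blast
  fix A B assume AB: "zariski_closed m A \<and> zariski_closed m B \<and> restrict_open Z = A \<union> B"
  have sub: "A \<subseteq> Y" "B \<subseteq> Y" using AB by (auto simp: restrict_open_def)
  have "\<pi> ` A \<union> \<pi> ` B = {z\<in>Z. g z \<noteq> 0}"
    using \<pi>_restrict_open[OF assms(2)] AB by (simp add: image_Un)
  hence "zariski_closure n {z\<in>Z. g z \<noteq> 0} \<subseteq> close_up A \<union> close_up B"
  proof -
    have "\<pi> ` A \<subseteq> close_up A" "\<pi> ` B \<subseteq> close_up B"
      unfolding close_up_def by (rule subset_zariski_closure; auto simp: \<pi>_Cn)+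
    hence "{z\<in>Z. g z \<noteq> 0} \<subseteq> close_up A \<union> close_up B"
      unfolding \<open>\<pi> ` A \<union> \<pi> ` B = {z\<in>Z. g z \<noteq> 0}\<close>[symmetric] by blast
    thus ?thesis
      by (rule zariski_closure_minimal[rotated])
        (simp add: close_up_def zariski_closed_Un)
  qed
  moreover have "close_up C \<subseteq> Z" if "C \<subseteq> restrict_open Z" for C
    unfolding close_up_def
    by (rule zariski_closure_minimal[OF Zc]) (use that in \<open>auto simp: restrict_open_def\<close>)
  ultimately have "Z = close_up A \<union> close_up B"
    using irreducible_dense_open[OF Z g assms(3,4)] AB by blast
  hence "Z = close_up A \<or> Z = close_up B"
    using conjunct2[OF conjunct2[OF Z[unfolded irreducible_closed_def]], rule_format,
        of "close_up A" "close_up B"] by (simp add: close_up_def)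
  thus "restrict_open Z = A \<or> restrict_open Z = B"
    using restrict_open_close_up[of A] restrict_open_close_up[of B] AB sub by auto
qed

lemma close_up_irreducible:
  assumes W: "irreducible_closed m W" and "W \<subseteq> Y"
  shows "irreducible_closed n (close_up W)"
  unfolding irreducible_closed_def
proof (intro conjI allI impI)
  have Wc: "zariski_closed m W" using W by (simp add: irreducible_closed_def)
  have sub: "\<pi> ` W \<subseteq> close_up W"
    unfolding close_up_def by (rule subset_zariski_closure) (auto simp: \<pi>_Cn)
  show "zariski_closed n (close_up W)" by (simp add: close_up_def)
  show "close_up W \<noteq> {}" using W sub by (auto simp: irreducible_closed_def)
  fix A B assume AB: "zariski_closed n A \<and> zariski_closed n B \<and> close_up W = A \<union> B"
  have "W = (W \<inter> restrict_open A) \<union> (W \<inter> restrict_open B)"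
    using AB sub assms(2) by (auto simp: restrict_open_def)
  moreover have "zariski_closed m (W \<inter> restrict_open A)" "zariski_closed m (W \<inter> restrict_open B)"
    using AB Wc by (auto intro: zariski_closed_Int restrict_open_closed)
  ultimately have "W = W \<inter> restrict_open A \<or> W = W \<inter> restrict_open B"
    using conjunct2[OF conjunct2[OF W[unfolded irreducible_closed_def]], rule_format,
        of "W \<inter> restrict_open A" "W \<inter> restrict_open B"] by simp
  hence "\<pi> ` W \<subseteq> A \<or> \<pi> ` W \<subseteq> B" by (auto simp: restrict_open_def)
  hence "close_up W \<subseteq> A \<or> close_up W \<subseteq> B"
    unfolding close_up_def using AB zariski_closure_minimal by blast
  thus "close_up W = A \<or> close_up W = B" using AB by blast
qed

lemma local_dim_eq:
  assumes x: "x \<in> X" "g x \<noteq> 0"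
  shows "local_dim m Y (\<Phi> x) = local_dim n X x"
proof -
  have "(\<exists>W. (\<forall>i\<le>d. irreducible_closed m (W i) \<and> \<Phi> x \<in> W i \<and> W i \<subseteq> Y) \<and>
             (\<forall>i<d. W i \<subset> W (Suc i))) \<longleftrightarrow>
        (\<exists>Z. (\<forall>i\<le>d. irreducible_closed n (Z i) \<and> x \<in> Z i \<and> Z i \<subseteq> X) \<and>
             (\<forall>i<d. Z i \<subset> Z (Suc i)))" (is "?L \<longleftrightarrow> ?R") for d :: nat
  proof
    assume ?L
    then obtain W where W: "\<And>i. i \<le> d \<Longrightarrow> irreducible_closed m (W i)" "\<And>i. i \<le> d \<Longrightarrow> \<Phi> x \<in> W i"
      "\<And>i. i \<le> d \<Longrightarrow> W i \<subseteq> Y" "\<And>i. i < d \<Longrightarrow> W i \<subset> W (Suc i)" by blast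
    have Wc: "zariski_closed m (W i)" if "i \<le> d" for i
      using W(1)[OF that] by (simp add: irreducible_closed_def)
    have ro: "restrict_open (close_up (W i)) = W i" if "i \<le> d" for i
      by (rule restrict_open_close_up[OF Wc W(3)]) (use that in auto)
    have in_X: "close_up (W i) \<subseteq> X" if "i \<le> d" for i
      unfolding close_up_def
      by (rule zariski_closure_minimal[OF X]) (use \<pi>_in(1) W(3)[OF that] in auto)
    have x_in: "x \<in> close_up (W i)" if "i \<le> d" for i
    proof -
      have "\<Phi> x \<in> restrict_open (close_up (W i))" using ro W(2) that by simp
      thus ?thesis using \<pi>_\<Phi>[OF x] by (simp add: restrict_open_def)
    qed
    have "close_up (W i) \<subset> close_up (W (Suc i))" if "i < d" for i
    proof
      show "close_up (W i) \<subseteq> close_up (W (Suc i))"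
        unfolding close_up_def by (rule zariski_closure_mono) (use W(4)[OF that] in blast)
      show "close_up (W i) \<noteq> close_up (W (Suc i))"
      proof
        assume "close_up (W i) = close_up (W (Suc i))"
        hence "restrict_open (close_up (W i)) = restrict_open (close_up (W (Suc i)))" by (rule arg_cong)
        thus False using ro[of i] ro[of "Suc i"] W(4)[OF that] that by simp
      qed
    qed
    thus ?R
      using close_up_irreducible[OF W(1) W(3)] in_X x_in
      by (intro exI[of _ "\<lambda>i. close_up (W i)"]) auto
  next
    assume ?R
    then obtain Z where Z: "\<And>i. i \<le> d \<Longrightarrow> irreducible_closed n (Z i)" "\<And>i. i \<le> d \<Longrightarrow> x \<in> Z i"
      "\<And>i. i \<le> d \<Longrightarrow> Z i \<subseteq> X" "\<And>i. i < d \<Longrightarrow> Z i \<subset> Z (Suc i)" by blast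
    have cu: "close_up (restrict_open (Z i)) = Z i" if "i \<le> d" for i
      using close_up_restrict_open[OF Z(1) Z(3) Z(2) x(2)] that by blast
    have x_in: "\<Phi> x \<in> restrict_open (Z i)" if "i \<le> d" for i
      using Z(2)[OF that] \<pi>_\<Phi>[OF x] \<Phi>_in[OF x] by (simp add: restrict_open_def)
    have "restrict_open (Z i) \<subset> restrict_open (Z (Suc i))" if "i < d" for i
    proof
      show "restrict_open (Z i) \<subseteq> restrict_open (Z (Suc i))"
        using Z(4)[OF that] by (auto simp: restrict_open_def)
      show "restrict_open (Z i) \<noteq> restrict_open (Z (Suc i))"
      proof
        assume "restrict_open (Z i) = restrict_open (Z (Suc i))"
        hence "close_up (restrict_open (Z i)) = close_up (restrict_open (Z (Suc i)))" by (rule arg_cong)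
        thus False using cu[of i] cu[of "Suc i"] Z(4)[OF that] that by simp
      qed
    qed
    thus ?L
      using restrict_open_irreducible[OF Z(1) Z(3) Z(2) x(2)] x_in
      by (intro exI[of _ "\<lambda>i. restrict_open (Z i)"]) (auto simp: restrict_open_def)
  qed
  thus ?thesis unfolding local_dim_def by simp
qed

definition d\<Phi> :: "cvec \<Rightarrow> cvec \<Rightarrow> cvec" where
  "d\<Phi> x v = (\<lambda>j. if j < m then
     (dirderiv n (a j) x v * g x - a j x * dirderiv n g x v) / (g x * g x) else 0)"

definition d\<pi> :: "cvec \<Rightarrow> cvec \<Rightarrow> cvec" where
  "d\<pi> y w = (\<lambda>i. if i < n then dirderiv m (s i) y w else 0)"

lemma linear_d\<Phi>: "Vector_Spaces.linear cscale cscale (d\<Phi> x)"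
proof -
  have "d\<Phi> x (v + w) = d\<Phi> x v + d\<Phi> x w" for v w
    by (rule ext) (simp add: d\<Phi>_def dirderiv_add algebra_simps add_divide_distrib diff_divide_distrib)
  moreover have "d\<Phi> x (cscale c v) = cscale c (d\<Phi> x v)" for c v
    unfolding d\<Phi>_def dirderiv_scale by (rule ext) (simp add: cscale_def algebra_simps diff_divide_distrib)
  ultimately show ?thesis
    unfolding Vector_Spaces.linear_iff using cvec.vector_space_axioms by blast
qed

lemma \<Phi>_has_derivative:
  assumes "g x \<noteq> 0" "j < m"
  shows "((\<lambda>t. \<Phi> (\<lambda>i. x i + t * v i) j) has_field_derivative d\<Phi> x v j) (at 0)"
proof -
  let ?\<gamma> = "\<lambda>t i. x i + t * v i"
  have 0: "?\<gamma> 0 = x" by auto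
  have 1: "((\<lambda>t. a j (?\<gamma> t)) has_field_derivative dirderiv n (a j) x v) (at 0)"
    by (rule polyfun_derivative_on_line[OF a[OF assms(2)]])
  have 2: "((\<lambda>t. g (?\<gamma> t)) has_field_derivative dirderiv n g x v) (at 0)"
    by (rule polyfun_derivative_on_line[OF g])
  show ?thesis
    using DERIV_divide[OF 1 2] assms by (simp add: d\<Phi>_def \<Phi>_def fraction_map_def)
qed

lemma \<pi>_has_derivative:
  assumes "i < n"
  shows "((\<lambda>t. \<pi> (\<lambda>j. y j + t * w j) i) has_field_derivative d\<pi> y w i) (at 0)"
  using polyfun_derivative_on_line[OF s[OF assms], of y w] assms
  by (simp add: d\<pi>_def \<pi>_def tuple_map_def)

text \<open>
  \<open>q \<circ> \<Phi>\<close> and \<open>e\<close> agree on the open part of \<open>X\<close> only, not in a neighbourhood in the ambient space.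
  Clearing denominators in their difference gives a polynomial \<open>G\<close> that vanishes on \<open>X\<close>, so its
  derivative in tangent directions is zero.
\<close>

lemma dirderiv_d\<Phi>:
  assumes x: "x \<in> X" "g x \<noteq> 0" and v: "v \<in> tangent_space n X x"
    and q: "polyfun UNIV m q" and e: "polyfun UNIV n e"
    and eq: "\<And>z. z \<in> X \<Longrightarrow> g z \<noteq> 0 \<Longrightarrow> q (\<Phi> z) = e z"
  shows "dirderiv m q (\<Phi> x) (d\<Phi> x v) = dirderiv n e x v"
proof -
  obtain b N where b: "polyfun UNIV n b" "\<And>x. g x \<noteq> 0 \<Longrightarrow> q (\<Phi> x) = b x / g x ^ N"
    using clear_denominators[OF q] by blast
  \<comment> \<open>The last factor makes \<open>G\<close> vanish where \<open>g\<close> does, so that \<open>G\<close> vanishes on all of \<open>X\<close>.\<close>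
  define G where "G = (\<lambda>z. (b z - e z * g z ^ N) * g z)"
  have G: "polyfun UNIV n G" unfolding G_def by (intro polyfun_intros b e g) auto
  have "G z = 0" if "z \<in> X" for z
    using b(2)[of z] eq[OF that] by (cases "g z = 0") (auto simp: G_def divide_simps)
  hence dG: "dirderiv n G x v = 0" using v G by (auto simp: tangent_space_iff)
  let ?\<gamma> = "\<lambda>t i. x i + t * v i"
  have line: "((\<lambda>t. f (?\<gamma> t)) has_field_derivative dirderiv n f x v) (at 0)"
    if "polyfun UNIV n f" for f
    by (rule polyfun_derivative_on_line[OF that])
  have "((\<lambda>t. q (\<Phi> (?\<gamma> t))) has_field_derivative dirderiv m q (\<Phi> x) (d\<Phi> x v)) (at 0)"
    using polyfun_chain_rule[OF q, of "\<lambda>t. \<Phi> (?\<gamma> t)" "d\<Phi> x v" 0] \<Phi>_has_derivative[OF x(2)] by simp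
  from DERIV_mult[OF DERIV_diff[OF this line[OF e]] DERIV_power[OF line[OF g], of "Suc N"]]
  have "((\<lambda>t. (q (\<Phi> (?\<gamma> t)) - e (?\<gamma> t)) * g (?\<gamma> t) ^ Suc N) has_field_derivative
      (dirderiv m q (\<Phi> x) (d\<Phi> x v) - dirderiv n e x v) * g x ^ Suc N) (at 0)"
    using eq[OF x] by simp
  also have "(\<lambda>t. (q (\<Phi> (?\<gamma> t)) - e (?\<gamma> t)) * g (?\<gamma> t) ^ Suc N) = (\<lambda>t. G (?\<gamma> t))"
  proof
    fix t
    show "(q (\<Phi> (?\<gamma> t)) - e (?\<gamma> t)) * g (?\<gamma> t) ^ Suc N = G (?\<gamma> t)"
      using b(2)[of "?\<gamma> t"] by (cases "g (?\<gamma> t) = 0") (auto simp: G_def field_simps)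
  qed
  finally have "(dirderiv m q (\<Phi> x) (d\<Phi> x v) - dirderiv n e x v) * g x ^ Suc N = dirderiv n G x v"
    using line[OF G] DERIV_unique by blast
  thus ?thesis using dG x(2) by simp
qed

lemma d\<Phi>_tangent:
  assumes x: "x \<in> X" "g x \<noteq> 0" and v: "v \<in> tangent_space n X x"
  shows "d\<Phi> x v \<in> tangent_space m Y (\<Phi> x)"
  unfolding tangent_space_iff
proof (intro conjI allI impI)
  show "d\<Phi> x v \<in> Cn m" by (simp add: d\<Phi>_def Cn_def)
  fix q assume "polyfun UNIV m q" "\<forall>y\<in>Y. q y = 0"
  hence "dirderiv m q (\<Phi> x) (d\<Phi> x v) = dirderiv n (\<lambda>_. 0) x v"
    using \<Phi>_in by (intro dirderiv_d\<Phi>[OF x v]) (auto intro: polyfun.intros)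
  thus "dirderiv m q (\<Phi> x) (d\<Phi> x v) = 0" by (simp add: dirderiv_def partial_deriv_def)
qed

lemma d\<pi>_d\<Phi>:
  assumes x: "x \<in> X" "g x \<noteq> 0" and v: "v \<in> tangent_space n X x"
  shows "d\<pi> (\<Phi> x) (d\<Phi> x v) = v"
proof
  fix i
  show "d\<pi> (\<Phi> x) (d\<Phi> x v) i = v i"
  proof (cases "i < n")
    case True
    have "s i (\<Phi> z) = z i" if "z \<in> X" "g z \<noteq> 0" for z
      using fun_cong[OF \<pi>_\<Phi>[OF that], of i] True by (simp add: \<pi>_def tuple_map_def)
    hence "dirderiv m (s i) (\<Phi> x) (d\<Phi> x v) = dirderiv n (\<lambda>x. x i) x v"
      using True by (intro dirderiv_d\<Phi>[OF x v]) (auto intro: polyfun.intros s)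
    also have "\<dots> = v i"
      by (rule DERIV_unique[OF polyfun_derivative_on_line[OF polyfun.coord[OF True]] has_derivative_on_line])
    finally show ?thesis using True by (simp add: d\<pi>_def)
  next
    case False
    thus ?thesis using v by (auto simp: tangent_space_iff Cn_def d\<pi>_def)
  qed
qed

lemma dirderiv_d\<pi>:
  assumes "polyfun UNIV n f"
  shows "((\<lambda>t. f (\<pi> (\<lambda>j. y j + t * w j))) has_field_derivative dirderiv n f (\<pi> y) (d\<pi> y w)) (at 0)"
  using polyfun_chain_rule[OF assms, of "\<lambda>t. \<pi> (\<lambda>j. y j + t * w j)" "d\<pi> y w" 0] \<pi>_has_derivative
  by simp

lemma d\<pi>_tangent:
  assumes w: "w \<in> tangent_space m Y y"
  shows "d\<pi> y w \<in> tangent_space n X (\<pi> y)"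
  unfolding tangent_space_iff
proof (intro conjI allI impI)
  show "d\<pi> y w \<in> Cn n" by (simp add: d\<pi>_def Cn_def)
  fix f assume f: "polyfun UNIV n f" "\<forall>x\<in>X. f x = 0"
  have "polyfun UNIV m (\<lambda>y. f (\<pi> y))" by (rule polyfun_comp_\<pi>[OF f(1)])
  moreover have "\<forall>y\<in>Y. f (\<pi> y) = 0" using f(2) \<pi>_in(1) by blast
  ultimately have "dirderiv m (\<lambda>y. f (\<pi> y)) y w = 0" using w by (auto simp: tangent_space_iff)
  moreover have "((\<lambda>t. f (\<pi> (\<lambda>j. y j + t * w j))) has_field_derivative
      dirderiv m (\<lambda>y. f (\<pi> y)) y w) (at 0)"
    by (rule polyfun_derivative_on_line[OF \<open>polyfun UNIV m (\<lambda>y. f (\<pi> y))\<close>])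
  ultimately show "dirderiv n f (\<pi> y) (d\<pi> y w) = 0"
    using DERIV_unique dirderiv_d\<pi>[OF f(1)] by metis
qed

text \<open>
  The equation \<open>\<Phi> (\<pi> z) = z\<close> holds on \<open>Y\<close> only. In the form \<open>a j (\<pi> z) = z j * g (\<pi> z)\<close> it is a
  polynomial equation of \<open>Y\<close>, which can be differentiated in tangent directions.
\<close>

lemma d\<Phi>_d\<pi>:
  assumes y: "y \<in> Y" and w: "w \<in> tangent_space m Y y"
  shows "d\<Phi> (\<pi> y) (d\<pi> y w) = w"
proof
  fix j
  show "d\<Phi> (\<pi> y) (d\<pi> y w) j = w j"
  proof (cases "j < m")
    case True
    let ?h = "\<lambda>y. a j (\<pi> y) - y j * g (\<pi> y)"
    have h: "polyfun UNIV m ?h"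
      by (intro polyfun_diff polyfun.mult polyfun.coord polyfun_comp_\<pi> a g True) simp
    have y_eq: "a j (\<pi> z) = z j * g (\<pi> z)" if "z \<in> Y" for z
      using fun_cong[OF \<Phi>_\<pi>[OF that], of j] True \<pi>_in(2)[OF that]
      by (simp add: \<Phi>_def fraction_map_def field_simps)
    hence "dirderiv m ?h y w = 0" using w h by (auto simp: tangent_space_iff)
    moreover have "((\<lambda>t. ?h (\<lambda>j. y j + t * w j)) has_field_derivative dirderiv m ?h y w) (at 0)"
      by (rule polyfun_derivative_on_line[OF h])
    moreover have "((\<lambda>t. ?h (\<lambda>j. y j + t * w j)) has_field_derivative
        dirderiv n (a j) (\<pi> y) (d\<pi> y w) - (w j * g (\<pi> y) + dirderiv n g (\<pi> y) (d\<pi> y w) * y j)) (at 0)"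
      using DERIV_diff[OF dirderiv_d\<pi>[OF a[OF True], of y w]
          DERIV_mult[OF has_derivative_on_line[of y j w] dirderiv_d\<pi>[OF g, of y w]]] by simp
    ultimately have "dirderiv n (a j) (\<pi> y) (d\<pi> y w) =
        w j * g (\<pi> y) + dirderiv n g (\<pi> y) (d\<pi> y w) * y j"
      using DERIV_unique by fastforce
    thus ?thesis
      using True y_eq[OF y] \<pi>_in(2)[OF y] by (simp add: d\<Phi>_def field_simps)
  next
    case False
    thus ?thesis using w by (auto simp: tangent_space_iff Cn_def d\<Phi>_def)
  qed
qed

lemma dim_tangent_space_eq:
  assumes x: "x \<in> X" "g x \<noteq> 0"
  shows "cvec.dim (tangent_space m Y (\<Phi> x)) = cvec.dim (tangent_space n X x)"
proof -
  have "cvec.dim (tangent_space n X x) = cvec.dim (tangent_space m Y (\<Phi> x))"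
  proof (rule cvec_dim_eq_if_mutually_inverse[OF linear_d\<Phi>[of x] subspace_tangent_space])
    show "d\<Phi> x ` tangent_space n X x \<subseteq> tangent_space m Y (\<Phi> x)"
      using d\<Phi>_tangent[OF x] by blast
    show "d\<pi> (\<Phi> x) ` tangent_space m Y (\<Phi> x) \<subseteq> tangent_space n X x"
      using d\<pi>_tangent[of _ "\<Phi> x"] \<pi>_\<Phi>[OF x] by auto
    show "d\<pi> (\<Phi> x) (d\<Phi> x v) = v" if "v \<in> tangent_space n X x" for v
      by (rule d\<pi>_d\<Phi>[OF x that])
    show "d\<Phi> x (d\<pi> (\<Phi> x) w) = w" if "w \<in> tangent_space m Y (\<Phi> x)" for w
      using d\<Phi>_d\<pi>[OF \<Phi>_in[OF x] that] \<pi>_\<Phi>[OF x] by simp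
  qed
  thus ?thesis by simp
qed

lemma smooth_transfer:
  assumes "\<forall>x\<in>X. smooth_at n X x" "y \<in> Y"
  shows "smooth_at m Y y"
proof -
  have x: "\<pi> y \<in> X" "g (\<pi> y) \<noteq> 0" using \<pi>_in assms(2) by auto
  show ?thesis
    using dim_tangent_space_eq[OF x] local_dim_eq[OF x] assms(1) x(1) \<Phi>_\<pi>[OF assms(2)]
    by (simp add: smooth_at_def)
qed

end

section \<open>Descent from a field to its real subfield\<close>

lemma complex_subfield_Int_Reals:
  assumes "complex_subfield Q"
  shows "complex_subfield (Q \<inter> \<real>)"
  using assms unfolding complex_subfield_def by auto

lemma polyfun_real_cnj:
  assumes "polyfun (Q \<inter> \<real>) n f"
  shows "f (conj_map x) = cnj (f x)"
  using assms by (induction rule: polyfun.induct) (auto simp: conj_map_def Reals_cnj_iff)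

text \<open>
  \<open>Q\<close> is spanned by \<open>1\<close> and \<open>w\<close> over \<open>Q \<inter> \<real>\<close>, and \<open>w * w\<close> is real.
\<close>

lemma polyfun_real_imaginary_parts:
  assumes Q: "complex_subfield Q" "cnj ` Q = Q" and w: "w \<in> Q" "cnj w = - w" "w \<noteq> 0"
    and f: "polyfun Q n f"
  obtains f1 f2 where "polyfun (Q \<inter> \<real>) n f1" "polyfun (Q \<inter> \<real>) n f2" "\<And>x. f x = f1 x + w * f2 x"
proof -
  note K = complex_subfield_Int_Reals[OF Q(1)]
  have "\<exists>f1 f2. polyfun (Q \<inter> \<real>) n f1 \<and> polyfun (Q \<inter> \<real>) n f2 \<and> (\<forall>x. f x = f1 x + w * f2 x)"
    using f
  proof (induction rule: polyfun.induct)
    case (const c)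
    let ?c1 = "(c + cnj c) / 2" and ?c2 = "(c - cnj c) / (2 * w)"
    have cc: "cnj c \<in> Q" using const Q(2) by blast
    have two: "2 \<in> Q" using complex_subfieldD(3)[OF Q(1), of 1 1] complex_subfieldD(2)[OF Q(1)] by simp
    have "?c1 \<in> Q"
      by (intro complex_subfield_divide[OF Q(1)] complex_subfieldD[OF Q(1)] const cc two)
    moreover have "?c1 \<in> \<real>" by (auto simp: Reals_cnj_iff)
    moreover have "?c2 \<in> Q"
      by (intro complex_subfield_divide[OF Q(1)] complex_subfieldD(4)[OF Q(1)] complex_subfield_diff[OF Q(1)] const cc two w(1))
    moreover have "?c2 \<in> \<real>" using w by (auto simp: Reals_cnj_iff field_simps)
    moreover have "c = ?c1 + w * ?c2" using w(3) by (simp add: field_simps)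
    ultimately show ?case
      by (intro exI[of _ "\<lambda>_. ?c1"] exI[of _ "\<lambda>_. ?c2"]) (auto intro: polyfun.const)
  next
    case (coord i)
    thus ?case
      by (intro exI[of _ "\<lambda>x. x i"] exI[of _ "\<lambda>_. 0"])
        (auto intro!: polyfun.coord polyfun.const complex_subfieldD[OF Q(1)])
  next
    case (add f h)
    then obtain f1 f2 h1 h2 where
      "polyfun (Q \<inter> \<real>) n f1" "polyfun (Q \<inter> \<real>) n f2" "\<And>x. f x = f1 x + w * f2 x"
      "polyfun (Q \<inter> \<real>) n h1" "polyfun (Q \<inter> \<real>) n h2" "\<And>x. h x = h1 x + w * h2 x" by blast
    thus ?case
      by (intro exI[of _ "\<lambda>x. f1 x + h1 x"] exI[of _ "\<lambda>x. f2 x + h2 x"])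
        (auto intro!: polyfun.add simp: algebra_simps)
  next
    case (mult f h)
    then obtain f1 f2 h1 h2 where fh:
      "polyfun (Q \<inter> \<real>) n f1" "polyfun (Q \<inter> \<real>) n f2" "\<And>x. f x = f1 x + w * f2 x"
      "polyfun (Q \<inter> \<real>) n h1" "polyfun (Q \<inter> \<real>) n h2" "\<And>x. h x = h1 x + w * h2 x" by blast
    have ww: "w * w \<in> Q \<inter> \<real>" using complex_subfieldD(4)[OF Q(1) w(1,1)] w(2) by (auto simp: Reals_cnj_iff)
    show ?case
      by (intro exI[of _ "\<lambda>x. f1 x * h1 x + (w * w) * (f2 x * h2 x)"]
          exI[of _ "\<lambda>x. f1 x * h2 x + f2 x * h1 x"] conjI polyfun.add polyfun.mult polyfun.const fh ww)
        (auto simp: fh(3,6) algebra_simps)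
  qed
  thus thesis using that by blast
qed

text \<open>
  If \<open>f = f\<^sub>1 + w f\<^sub>2\<close> vanishes at \<open>y\<close> and at its conjugate, then \<open>f\<^sub>1 + w f\<^sub>2\<close> and \<open>f\<^sub>1 - w f\<^sub>2\<close> both vanish
  at \<open>y\<close>. So the real parts \<open>f\<^sub>1\<close>, \<open>f\<^sub>2\<close> of the equations cut out the same set.
\<close>

lemma conj_invariant_imp_algebraic_over_reals:
  assumes Q: "complex_subfield Q" "cnj ` Q = Q" and w: "w \<in> Q" "cnj w = - w" "w \<noteq> 0"
    and Y: "algebraic_set_over Q m Y" and conj: "\<And>y. y \<in> Y \<Longrightarrow> conj_map y \<in> Y"
  shows "algebraic_set_over (Q \<inter> \<real>) m Y"
proof -
  obtain A where A: "finite A" "\<And>f. f \<in> A \<Longrightarrow> polyfun Q m f" "Y = {y\<in>Cn m. \<forall>f\<in>A. f y = 0}"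
    using Y unfolding algebraic_set_over_iff[OF Q(1)] by blast
  have "\<exists>f1 f2. polyfun (Q \<inter> \<real>) m f1 \<and> polyfun (Q \<inter> \<real>) m f2 \<and> (\<forall>x. f x = f1 x + w * f2 x)"
    if "f \<in> A" for f
    using polyfun_real_imaginary_parts[OF Q w A(2)[OF that]] by metis
  then obtain F1 F2 where F: "\<And>f. f \<in> A \<Longrightarrow> polyfun (Q \<inter> \<real>) m (F1 f)"
    "\<And>f. f \<in> A \<Longrightarrow> polyfun (Q \<inter> \<real>) m (F2 f)" "\<And>f x. f \<in> A \<Longrightarrow> f x = F1 f x + w * F2 f x"
    by metis
  have zero: "F1 f y = 0 \<and> F2 f y = 0" if f: "f \<in> A" and y: "y \<in> Y" for f y
  proof -
    have 1: "F1 f y + w * F2 f y = 0"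
      using F(3)[OF f, of y] y f A(3) by auto
    have "f (conj_map y) = 0" using conj[OF y] f A(3) by auto
    hence "cnj (F1 f y) + w * cnj (F2 f y) = 0"
      unfolding F(3)[OF f, of "conj_map y"] using polyfun_real_cnj F(1,2)[OF f] by metis
    hence "cnj (cnj (F1 f y) + w * cnj (F2 f y)) = 0" by simp
    hence 2: "F1 f y - w * F2 f y = 0" by (simp add: w(2))
    have "F1 f y = 0" using 1 2 by (simp add: eq_neg_iff_add_eq_0[symmetric])
    thus ?thesis using 1 w(3) by simp
  qed
  show ?thesis
    unfolding algebraic_set_over_iff[OF complex_subfield_Int_Reals[OF Q(1)]]
  proof (intro exI[of _ "F1 ` A \<union> F2 ` A"] conjI ballI)
    show "finite (F1 ` A \<union> F2 ` A)" using A(1) by simp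
    show "polyfun (Q \<inter> \<real>) m f" if "f \<in> F1 ` A \<union> F2 ` A" for f using that F(1,2) by blast
    show "Y = {x \<in> Cn m. \<forall>f\<in>F1 ` A \<union> F2 ` A. f x = 0}"
    proof (intro subset_antisym subsetI)
      fix y assume "y \<in> Y"
      thus "y \<in> {x \<in> Cn m. \<forall>f\<in>F1 ` A \<union> F2 ` A. f x = 0}" using zero A(3) by auto
    next
      fix y assume y: "y \<in> {x \<in> Cn m. \<forall>f\<in>F1 ` A \<union> F2 ` A. f x = 0}"
      hence 0: "\<forall>f\<in>F1 ` A \<union> F2 ` A. f y = 0" by simp
      have "f y = 0" if "f \<in> A" for f
      proof -
        have "F1 f y = 0" "F2 f y = 0" by (rule bspec[OF 0]; use that in simp)+
        thus ?thesis using F(3)[OF that, of y] by simp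
      qed
      thus "y \<in> Y" using y A(3) by simp
    qed
  qed
qed

section \<open>Rational maps and the standard conjugation\<close>

lemma zariski_dense_in_self: "X \<subseteq> Cn n \<Longrightarrow> zariski_dense_in n X X"
  using subset_zariski_closure by (auto simp: zariski_dense_in_def)

lemma rat_tuple_of_polyfuns:
  assumes "complex_subfield F" "\<And>i. i < m \<Longrightarrow> polyfun F n (p i)" "\<And>i. i < m \<Longrightarrow> polyfun F n (q i)"
  obtains r :: rat_tuple where
    "\<And>i. i < m \<Longrightarrow> fst (r i) \<in> polys F n" "\<And>i. i < m \<Longrightarrow> snd (r i) \<in> polys F n"
    "\<And>i x. i < m \<Longrightarrow> peval (fst (r i)) x = p i x" "\<And>i x. i < m \<Longrightarrow> peval (snd (r i)) x = q i x"
proof -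
  have "\<exists>u. fst u \<in> polys F n \<and> snd u \<in> polys F n \<and> peval (fst u) = p i \<and> peval (snd u) = q i"
    if "i < m" for i
    using assms(2,3)[OF that] unfolding polyfun_iff_peval[OF assms(1)] by (metis fst_conv snd_conv)
  then obtain r where "\<And>i. i < m \<Longrightarrow> fst (r i) \<in> polys F n \<and> snd (r i) \<in> polys F n \<and>
      peval (fst (r i)) = p i \<and> peval (snd (r i)) = q i" by metis
  thus thesis using that by metis
qed

lemma rat_tuple_identity:
  assumes "complex_subfield F"
  obtains r :: rat_tuple where
    "\<And>i. i < n \<Longrightarrow> fst (r i) \<in> polys F n" "\<And>i. i < n \<Longrightarrow> snd (r i) \<in> polys F n"
    "\<And>X. rat_dom n r X = X" "\<And>x. x \<in> Cn n \<Longrightarrow> rat_eval n r x = x"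
proof -
  obtain r :: rat_tuple where r:
    "\<And>i. i < n \<Longrightarrow> fst (r i) \<in> polys F n" "\<And>i. i < n \<Longrightarrow> snd (r i) \<in> polys F n"
    "\<And>i x. i < n \<Longrightarrow> peval (fst (r i)) x = x i" "\<And>i x. i < n \<Longrightarrow> peval (snd (r i)) x = 1"
    by (rule rat_tuple_of_polyfuns[OF assms, of n n "\<lambda>i x. x i" "\<lambda>_ _. 1"])
      (auto intro: polyfun.intros complex_subfieldD[OF assms])
  show thesis
  proof (rule that[of r])
    show "rat_dom n r X = X" for X using r(4) by (auto simp: rat_dom_def)
    show "rat_eval n r x = x" if "x \<in> Cn n" for x
      using that r(3,4) by (auto simp: rat_eval_def Cn_def fun_eq_iff)
  qed (use r in auto)
qed

lemma real_isomorphic_refl: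
  assumes "X \<subseteq> Cn n" "\<And>x. x \<in> X \<Longrightarrow> L x \<in> X"
  shows "real_isomorphic n X L n X L"
proof -
  obtain r :: rat_tuple where r:
    "\<And>i. i < n \<Longrightarrow> fst (r i) \<in> polys UNIV n" "\<And>i. i < n \<Longrightarrow> snd (r i) \<in> polys UNIV n"
    "\<And>X. rat_dom n r X = X" "\<And>x. x \<in> Cn n \<Longrightarrow> rat_eval n r x = x"
    using rat_tuple_identity[OF complex_subfield_UNIV] by metis
  have e: "rat_eval n r x = x" if "x \<in> X" for x using r(4) assms(1) that by blast
  have rm: "rational_map UNIV n X n X r"
    unfolding rational_map_def r(3) using r(1,2) zariski_dense_in_self[OF assms(1)] e by auto
  have "{x \<in> X. rat_eval n r x \<in> X \<and> rat_eval n r (rat_eval n r x) = x} = X" using e by auto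
  hence rl: "rational_left_inverse n X n X r r"
    unfolding rational_left_inverse_def r(3) using zariski_dense_in_self[OF assms(1)] by simp
  have "{y \<in> X. L (rat_eval n r y) \<in> X \<and> L y = rat_eval n r (L (rat_eval n r y))} = X"
    using e assms(2) by auto
  hence "zariski_dense_in n X
    {y \<in> rat_dom n r X. L (rat_eval n r y) \<in> rat_dom n r X \<and> L y = rat_eval n r (L (rat_eval n r y))}"
    unfolding r(3) using zariski_dense_in_self[OF assms(1)] by simp
  thus ?thesis unfolding real_isomorphic_def birational_iso_def using rm rl by blast
qed

lemma conj_map_symmetry:
  assumes Y: "Y \<subseteq> Cn m" and conj: "\<And>y. y \<in> Y \<Longrightarrow> conj_map y \<in> Y" and "\<exists>y\<in>Y. conj_map y \<noteq> y"
  shows "symmetry m Y conj_map"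
proof -
  have im: "conj_map ` Y = Y"
    using conj by (auto intro: image_eqI[where x = "conj_map y" for y])
  have inj: "inj_on conj_map Y" by (rule inj_on_inverseI[of _ conj_map]) simp
  have id: "conj_map \<circ> conj_map = id" by (auto simp: fun_eq_iff)
  have "antiholomorphic_map m Y conj_map"
    unfolding antiholomorphic_map_def holomorphic_function_def
  proof (intro allI impI ballI)
    fix i y assume "i < m" "y \<in> Y"
    have "continuous_on (UNIV \<inter> Cn m) (\<lambda>x :: cvec. x i)"
      by (rule continuous_on_subset[OF continuous_on_product_coordinates]) simp
    moreover have "(\<lambda>t. (x(j := t)) i) field_differentiable at (x j)" for x :: cvec and j
      by (cases "i = j") auto
    ultimately have "holomorphic_on_open m UNIV (\<lambda>x. x i)"
      unfolding holomorphic_on_open_def by blast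
    thus "\<exists>N g. open N \<and> y \<in> N \<and> holomorphic_on_open m N g \<and>
        (\<forall>z\<in>N \<inter> Y. cnj (conj_map z i) = g z)"
      by (intro exI[of _ UNIV] exI[of _ "\<lambda>x. x i"]) (auto simp: conj_map_def)
  qed
  moreover have reg: "regular_map m Y m Y f" if f: "\<And>y. y \<in> Y \<Longrightarrow> f y = y" for f
  proof -
    obtain r :: rat_tuple where r: "\<And>i. i < m \<Longrightarrow> fst (r i) \<in> polys UNIV m"
      "\<And>i x. i < m \<Longrightarrow> peval (fst (r i)) x = x i"
      by (rule rat_tuple_of_polyfuns[OF complex_subfield_UNIV, of m m "\<lambda>i x. x i" "\<lambda>_ _. 1"])
        (auto intro: polyfun.intros)
    have "f y = (\<lambda>i. if i < m then peval (fst (r i)) y else 0)" if "y \<in> Y" for y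
      using that Y r(2) f by (auto simp: Cn_def fun_eq_iff)
    thus ?thesis
      unfolding regular_map_def using f r(1) by (auto intro!: exI[of _ "\<lambda>i. fst (r i)"])
  qed
  moreover have "biregular_iso m Y m (conj_map ` Y) (conj_map \<circ> conj_map)"
    unfolding biregular_iso_def im id
    using reg[of id] reg[of "inv_into Y id"] by (auto intro: inv_into_f_eq)
  ultimately show ?thesis
    unfolding symmetry_def using inj im assms(3) by (auto simp: bij_betw_def)
qed

lemma conj_map_defined_over:
  assumes F: "complex_subfield F" and Y: "algebraic_set_over F m Y"
    and conj: "\<And>y. y \<in> Y \<Longrightarrow> conj_map y \<in> Y"
  shows "defined_over F m Y conj_map"
proof -
  have im: "conj_map ` Y = Y"
    using conj by (auto intro: image_eqI[where x = "conj_map y" for y])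
  have YC: "Y \<subseteq> Cn m"
    using algebraic_imp_zariski_closed[OF F Y] by (rule zariski_closed_subset_Cn)
  obtain r :: rat_tuple where r:
    "\<And>i. i < m \<Longrightarrow> fst (r i) \<in> polys F m" "\<And>i. i < m \<Longrightarrow> snd (r i) \<in> polys F m"
    "\<And>X. rat_dom m r X = X" "\<And>x. x \<in> Cn m \<Longrightarrow> rat_eval m r x = x"
    using rat_tuple_identity[OF F] by metis
  have "rational_map F m Y m Y r"
    unfolding rational_map_def r(3) using r(1,2,4) zariski_dense_in_self[OF YC] YC
    by (auto simp: subset_iff)
  hence "map_defined_over F m Y m (conj_map ` Y) (conj_map \<circ> conj_map)"
    unfolding map_defined_over_def im r(3) using r(3,4) YC by (intro exI[of _ r]) (auto simp: subset_iff)
  thus ?thesis using Y by (simp add: defined_over_def)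
qed

section \<open>The real form\<close>

text \<open>
  The data extracted from a real algebraic variety over a nonreal field \<open>Q\<close>. The conjugate \<open>\<psi>\<close> of \<open>L\<close>
  comes in two guises: by polynomials \<open>P i\<close> with complex coefficients on all of \<open>X\<close>, and by fractions
  \<open>num i / den i\<close> over \<open>Q\<close> on a dense subset. The first makes \<open>\<psi>\<close> a morphism, the second gives
  equations over \<open>Q\<close>.
\<close>

locale conjugation_data =
  fixes Q :: "complex set" and n :: nat and X :: "cvec set" and L :: "cvec \<Rightarrow> cvec"
    and w :: complex and eqs :: "(cvec \<Rightarrow> complex) set"
    and P num den :: "nat \<Rightarrow> cvec \<Rightarrow> complex" and \<psi> :: "cvec \<Rightarrow> cvec"
  defines "\<psi> \<equiv> tuple_map n P"
  assumes Q: "complex_subfield Q" "cnj ` Q = Q" and w: "w \<in> Q" "cnj w = - w" "w \<noteq> 0"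
    and eqs: "finite eqs" "\<And>f. f \<in> eqs \<Longrightarrow> polyfun Q n f"
    and X_eq: "X = {x\<in>Cn n. \<forall>f\<in>eqs. f x = 0}"
    and L_in: "\<And>x. x \<in> X \<Longrightarrow> L x \<in> X" and L_L: "\<And>x. x \<in> X \<Longrightarrow> L (L x) = x"
    and L_nontrivial: "\<exists>x\<in>X. L x \<noteq> x"
    and P: "\<And>i. i < n \<Longrightarrow> polyfun UNIV n (P i)"
    and conj_L: "\<And>x. x \<in> X \<Longrightarrow> conj_map (L x) = \<psi> x"
    and num: "\<And>i. i < n \<Longrightarrow> polyfun Q n (num i)" and den: "\<And>i. i < n \<Longrightarrow> polyfun Q n (den i)"
    and dense: "X \<subseteq> zariski_closure n {x\<in>X. \<forall>i<n. den i x \<noteq> 0}"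
    and frac: "\<And>x i. x \<in> X \<Longrightarrow> \<forall>i<n. den i x \<noteq> 0 \<Longrightarrow> i < n \<Longrightarrow> P i x = num i x / den i x"
    and smooth: "\<forall>x\<in>X. smooth_at n X x"
begin

text \<open>
  On \<open>X\<close>, \<open>hbar (\<psi> x)\<close> is the conjugate of \<open>h (L x)\<close>; hence \<open>g\<close> is nonzero exactly where \<open>h\<close> vanishes
  neither at \<open>x\<close> nor at \<open>L x\<close>.
\<close>

definition h :: "cvec \<Rightarrow> complex" where "h x = (\<Prod>i<n. den i x)"
definition hbar :: "cvec \<Rightarrow> complex" where "hbar x = cnj (h (conj_map x))"
definition g :: "cvec \<Rightarrow> complex" where "g x = h x * hbar (\<psi> x)"
definition U :: "cvec set" where "U = {x\<in>X. g x \<noteq> 0}"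
definition m :: nat where "m = 2 * n + 1"

lemma XC: "X \<subseteq> Cn n" by (auto simp: X_eq)

lemma X_closed: "zariski_closed n X"
  unfolding X_eq by (rule zariski_closed_zero_locus) (use eqs(2) polyfun_UNIV in blast)

lemma h_nz_iff: "h x \<noteq> 0 \<longleftrightarrow> (\<forall>i<n. den i x \<noteq> 0)"
  by (auto simp: h_def)

lemma h: "polyfun Q n h"
  unfolding h_def by (intro polyfun_prod Q den) simp

lemma hbar: "polyfun Q n hbar"
proof -
  have "hbar = (\<lambda>x. cnj (h (conj_map x)))" by (simp add: fun_eq_iff hbar_def)
  thus ?thesis using polyfun_cnj[OF h] Q(2) by simp
qed

lemma polyfun_comp_\<psi>: "polyfun UNIV n f \<Longrightarrow> polyfun UNIV n (\<lambda>x. f (\<psi> x))"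
  by (rule polyfun_compose) (auto simp: \<psi>_def tuple_map_def intro: P)

lemma g: "polyfun UNIV n g"
  unfolding g_def by (intro polyfun.mult polyfun_comp_\<psi> polyfun_UNIV[OF h] polyfun_UNIV[OF hbar])

lemma L_eq: "x \<in> X \<Longrightarrow> L x = conj_map (\<psi> x)"
  using conj_L[of x] by (metis conj_map_conj_map)

lemma \<psi>_L: "x \<in> X \<Longrightarrow> \<psi> (L x) = conj_map x"
  using conj_L[OF L_in] L_L by simp

lemma hbar_\<psi>: "x \<in> X \<Longrightarrow> hbar (\<psi> x) = cnj (h (L x))"
  by (simp add: hbar_def L_eq)

lemma g_L:
  assumes "x \<in> X"
  shows "g (L x) = cnj (g x)"
  using hbar_\<psi>[OF assms] hbar_\<psi>[OF L_in[OF assms]] L_L[OF assms] by (simp add: g_def)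

lemma L_U: "x \<in> U \<Longrightarrow> L x \<in> U"
  using L_in g_L by (auto simp: U_def)

text \<open>
  Suppose that \<open>f\<close> vanishes on \<open>U\<close>. Then \<open>f\<close> times \<open>hbar \<circ> \<psi>\<close> vanishes where \<open>h \<noteq> 0\<close>, hence on \<open>X\<close>.
  Consequently \<open>f \<circ> L\<close> vanishes where \<open>h \<noteq> 0\<close>. It is the conjugate of a polynomial function, so it
  vanishes on \<open>X\<close> as well, and \<open>L\<close> maps \<open>X\<close> onto itself.
\<close>

lemma U_dense: "X \<subseteq> zariski_closure n U"
proof
  fix x assume x: "x \<in> X"
  have D: "f z = 0" if "polyfun UNIV n f" "\<And>y. y \<in> X \<Longrightarrow> h y \<noteq> 0 \<Longrightarrow> f y = 0" "z \<in> X" for f z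
    using dense that unfolding h_nz_iff subset_iff zariski_closure_iff by blast
  have "f x = 0" if f: "polyfun UNIV n f" and 0: "\<And>y. y \<in> U \<Longrightarrow> f y = 0" for f
  proof -
    have 1: "f z * hbar (\<psi> z) = 0" if "z \<in> X" for z
    proof (rule D[OF _ _ that])
      show "polyfun UNIV n (\<lambda>z. f z * hbar (\<psi> z))"
        by (intro polyfun.mult polyfun_comp_\<psi> polyfun_UNIV[OF hbar] f)
      show "f y * hbar (\<psi> y) = 0" if "y \<in> X" "h y \<noteq> 0" for y
        using 0[of y] that by (auto simp: U_def g_def)
    qed
    have 2: "cnj (f (conj_map (\<psi> z))) = 0" if "z \<in> X" for z
    proof (rule D[OF _ _ that])
      have "polyfun UNIV n (\<lambda>x. cnj (f (conj_map x)))"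
        using polyfun_cnj[OF f] by (rule polyfun_UNIV)
      thus "polyfun UNIV n (\<lambda>z. cnj (f (conj_map (\<psi> z))))" by (rule polyfun_comp_\<psi>)
      show "cnj (f (conj_map (\<psi> y))) = 0" if "y \<in> X" "h y \<noteq> 0" for y
        using 1[OF L_in[OF that(1)]] hbar_\<psi>[OF L_in[OF that(1)]] L_L[OF that(1)] L_eq[OF that(1)] that(2)
        by simp
    qed
    show "f x = 0" using 2[OF L_in[OF x]] L_eq[OF L_in[OF x]] L_L[OF x] by simp
  qed
  thus "x \<in> zariski_closure n U" using x XC by (auto simp: zariski_closure_iff)
qed

text \<open>
  Numerators over the common denominator \<open>g\<close>: \<open>\<Phi> x\<close> has the coordinates \<open>x + \<psi> x\<close>, \<open>w (x - \<psi> x)\<close> and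
  \<open>1 / g x\<close>. The maps \<open>s\<close> and \<open>s'\<close> recover \<open>x\<close> and \<open>\<psi> x\<close> from the first two.
\<close>

definition a :: "nat \<Rightarrow> cvec \<Rightarrow> complex" where
  "a j = (if j < n then (\<lambda>x. (x j + P j x) * g x)
     else if j < 2 * n then (\<lambda>x. w * (x (j - n) - P (j - n) x) * g x) else (\<lambda>_. 1))"

definition s :: "nat \<Rightarrow> cvec \<Rightarrow> complex" where "s i y = (y i + y (n + i) / w) / 2"
definition s' :: "nat \<Rightarrow> cvec \<Rightarrow> complex" where "s' i y = (y i - y (n + i) / w) / 2"

abbreviation "\<Phi> \<equiv> fraction_map m a g"
abbreviation "\<pi> \<equiv> tuple_map n s"
abbreviation "\<pi>' \<equiv> tuple_map n s'"

text \<open>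
  With \<open>x = \<pi> y\<close> and \<open>x' = \<pi>' y\<close>, the equations say that \<open>x\<close> lies on \<open>X\<close>, that \<open>x'\<close> satisfies the equations
  with coefficients in \<open>Q\<close> that \<open>\<psi> x\<close> satisfies, and that no denominator vanishes. The last condition
  makes the second one determine \<open>x'\<close>.
\<close>

definition Y :: "cvec set" where
  "Y = {y\<in>Cn m. (\<forall>f\<in>eqs. f (\<pi> y) = 0) \<and> (\<forall>i<n. s' i y * den i (\<pi> y) = num i (\<pi> y)) \<and>
     y (2 * n) * h (\<pi> y) * hbar (\<pi>' y) = 1}"

lemma s_polyfun: "i < n \<Longrightarrow> polyfun Q m (s i)" "i < n \<Longrightarrow> polyfun Q m (s' i)"
  unfolding s_def s'_def
  by (intro polyfun_divide_const polyfun.add polyfun_diff polyfun.coord Q w;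
    use complex_subfieldD(3)[OF Q(1), of 1 1] complex_subfieldD(2)[OF Q(1)] in \<open>simp add: m_def\<close>)+

lemma Y_algebraic: "algebraic_set_over Q m Y"
  unfolding algebraic_set_over_iff[OF Q(1)]
proof (intro exI conjI ballI)
  let ?A = "(\<lambda>f y. f (\<pi> y)) ` eqs \<union> (\<lambda>i y. s' i y * den i (\<pi> y) - num i (\<pi> y)) ` {..<n}
    \<union> {\<lambda>y. y (2 * n) * h (\<pi> y) * hbar (\<pi>' y) - 1}"
  show "finite ?A" using eqs(1) by simp
  show "Y = {y\<in>Cn m. \<forall>f\<in>?A. f y = 0}" unfolding Y_def by (auto simp: ball_Un)
  have c: "polyfun Q m (\<lambda>y. f (\<pi> y))" "polyfun Q m (\<lambda>y. f (\<pi>' y))" if "polyfun Q n f" for f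
    by (rule polyfun_compose[OF that]; use s_polyfun in \<open>simp add: tuple_map_def\<close>)+
  have t: "polyfun Q m (\<lambda>y. y (2 * n))" by (rule polyfun.coord) (simp add: m_def)
  fix f assume "f \<in> ?A"
  then consider e where "e \<in> eqs" "f = (\<lambda>y. e (\<pi> y))"
    | i where "i < n" "f = (\<lambda>y. s' i y * den i (\<pi> y) - num i (\<pi> y))"
    | "f = (\<lambda>y. y (2 * n) * h (\<pi> y) * hbar (\<pi>' y) - 1)" by blast
  thus "polyfun Q m f"
  proof cases
    case 1
    thus ?thesis using c(1)[OF eqs(2)] by simp
  next
    case 2
    thus ?thesis
      using c(1)[OF num] c(1)[OF den] s_polyfun(2) by (auto intro!: polyfun_diff[OF Q(1)] polyfun.mult)
  next
    case 3
    show ?thesis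
      unfolding 3 by (intro polyfun_diff[OF Q(1)] polyfun.mult polyfun.const t c h hbar complex_subfieldD(2)[OF Q(1)])
  qed
qed

lemma \<Phi>_apply:
  assumes "g x \<noteq> 0"
  shows "i < n \<Longrightarrow> \<Phi> x i = x i + P i x" "i < n \<Longrightarrow> \<Phi> x (n + i) = w * (x i - P i x)"
    "\<Phi> x (2 * n) = 1 / g x" "j > 2 * n \<Longrightarrow> \<Phi> x j = 0"
  using assms by (auto simp: fraction_map_def a_def m_def)

lemma \<pi>_\<Phi>:
  assumes "x \<in> X" "g x \<noteq> 0"
  shows "\<pi> (\<Phi> x) = x" "\<pi>' (\<Phi> x) = \<psi> x"
proof -
  have "x \<in> Cn n" using assms(1) XC by blast
  thus "\<pi> (\<Phi> x) = x"
    using w(3) \<Phi>_apply[OF assms(2)]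
    by (auto simp: tuple_map_def s_def Cn_def fun_eq_iff)
  show "\<pi>' (\<Phi> x) = \<psi> x"
    using w(3) \<Phi>_apply[OF assms(2)]
    by (auto simp: tuple_map_def \<psi>_def s'_def fun_eq_iff)
qed

lemma \<Phi>_in_Y:
  assumes "x \<in> X" "g x \<noteq> 0"
  shows "\<Phi> x \<in> Y"
proof -
  have hx: "h x \<noteq> 0" "hbar (\<psi> x) \<noteq> 0" using assms(2) by (auto simp: g_def)
  have "s' i (\<Phi> x) * den i x = num i x" if "i < n" for i
  proof -
    have "s' i (\<Phi> x) = P i x" using fun_cong[OF \<pi>_\<Phi>(2)[OF assms], of i] that
      by (simp add: tuple_map_def \<psi>_def)
    thus ?thesis using frac[OF assms(1) _ that] hx(1) that unfolding h_nz_iff by simp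
  qed
  moreover have "\<Phi> x (2 * n) * h x * hbar (\<psi> x) = 1"
    using hx \<Phi>_apply(3)[OF assms(2)] by (simp add: g_def)
  moreover have "\<Phi> x \<in> Cn m" by (simp add: fraction_map_def Cn_def)
  ultimately show ?thesis using assms(1) by (auto simp: Y_def \<pi>_\<Phi>[OF assms] X_eq)
qed

lemma Y_point:
  assumes "y \<in> Y"
  shows "\<pi> y \<in> X" "g (\<pi> y) \<noteq> 0" "\<Phi> (\<pi> y) = y"
proof -
  show x: "\<pi> y \<in> X" using assms by (auto simp: Y_def X_eq Cn_def tuple_map_def)
  have t: "y (2 * n) * h (\<pi> y) * hbar (\<pi>' y) = 1" using assms by (simp add: Y_def)
  hence d: "\<forall>i<n. den i (\<pi> y) \<noteq> 0" unfolding h_nz_iff[symmetric] by auto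
  have s': "s' i y = P i (\<pi> y)" if "i < n" for i
    
  proof -
    have "s' i y * den i (\<pi> y) = num i (\<pi> y)" using assms that by (simp add: Y_def)
    thus ?thesis using d that frac[OF x d that] by (metis nonzero_eq_divide_eq)
  qed
  hence "\<pi>' y = \<psi> (\<pi> y)" by (auto simp: tuple_map_def \<psi>_def fun_eq_iff)
  hence t': "y (2 * n) * g (\<pi> y) = 1" using t by (simp add: g_def mult_ac)
  thus g: "g (\<pi> y) \<noteq> 0" by auto
  show "\<Phi> (\<pi> y) = y"
  proof
    fix j
    consider "j < n" | i where "i < n" "j = n + i" | "j = 2 * n" | "j > 2 * n"
      by (metis add_diff_inverse_nat linorder_neqE_nat mult_2 nat_add_left_cancel_less)
    thus "\<Phi> (\<pi> y) j = y j"
    proof cases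
      case 1
      have e: "\<pi> y j = s j y" using 1 by (simp add: tuple_map_def)
      show ?thesis
        unfolding \<Phi>_apply(1)[OF g 1] s'[OF 1, symmetric] e s_def s'_def
        by (simp add: add_divide_distrib diff_divide_distrib)
    next
      case (2 i)
      have e: "\<pi> y i = s i y" using 2(1) by (simp add: tuple_map_def)
      show ?thesis
        unfolding 2(2) \<Phi>_apply(2)[OF g 2(1)] s'[OF 2(1), symmetric] e s_def s'_def
        using w(3) by (simp add: field_simps)
    next
      case 3
      have "1 / g (\<pi> y) = y (2 * n)" by (subst t'[symmetric]) (simp add: g)
      thus ?thesis unfolding 3 \<Phi>_apply(3)[OF g] .
    next
      case 4
      thus ?thesis using \<Phi>_apply(4)[OF g] assms by (auto simp: Y_def Cn_def m_def)
    qed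
  qed
qed

text \<open>
  The coordinates of \<open>\<Phi>\<close> are chosen for this purpose: passing from \<open>x\<close> to \<open>L x\<close> replaces the pair
  \<open>(x, \<psi> x)\<close> by the conjugate of \<open>(\<psi> x, x)\<close>, and \<open>w\<close> changes its sign under conjugation.
\<close>

lemma conj_\<Phi>:
  assumes "x \<in> X" "g x \<noteq> 0"
  shows "conj_map (\<Phi> x) = \<Phi> (L x)"
proof
  fix j
  have gL: "g (L x) \<noteq> 0" using g_L[OF assms(1)] assms(2) by simp
  have PL: "P i (L x) = cnj (x i)" if "i < n" for i
    using fun_cong[OF \<psi>_L[OF assms(1)], of i] that by (simp add: \<psi>_def tuple_map_def conj_map_def)
  have Lx: "L x i = cnj (P i x)" if "i < n" for i
    using L_eq[OF assms(1)] that by (simp add: \<psi>_def tuple_map_def conj_map_def)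
  consider "j < n" | i where "i < n" "j = n + i" | "j = 2 * n" | "j > 2 * n"
    by (metis add_diff_inverse_nat linorder_neqE_nat mult_2 nat_add_left_cancel_less)
  thus "conj_map (\<Phi> x) j = \<Phi> (L x) j"
  proof cases
    case 1
    thus ?thesis
      by (simp add: conj_map_def \<Phi>_apply(1)[OF assms(2)] \<Phi>_apply(1)[OF gL] PL Lx)
  next
    case (2 i)
    thus ?thesis
      by (simp add: conj_map_def \<Phi>_apply(2)[OF assms(2)] \<Phi>_apply(2)[OF gL] PL Lx w(2) right_diff_distrib)
  next
    case 3
    thus ?thesis
      by (simp add: conj_map_def \<Phi>_apply(3)[OF assms(2)] \<Phi>_apply(3)[OF gL] g_L[OF assms(1)])
  next
    case 4
    thus ?thesis
      by (simp add: conj_map_def \<Phi>_apply(4)[OF assms(2)] \<Phi>_apply(4)[OF gL])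
  qed
qed

lemma Y_conj: "y \<in> Y \<Longrightarrow> conj_map y \<in> Y"
  using conj_\<Phi>[of "\<pi> y"] Y_point[of y] \<Phi>_in_Y[of "L (\<pi> y)"] L_in[of "\<pi> y"] g_L[of "\<pi> y"] by simp

lemma Y_closed: "zariski_closed m Y"
  by (rule algebraic_imp_zariski_closed[OF Q(1) Y_algebraic])

lemma chart: "principal_open_chart n m X Y g a s"
proof
  show "polyfun UNIV m (s i)" if "i < n" for i
    using s_polyfun(1)[OF that] by (rule polyfun_UNIV)
  show "polyfun UNIV n (a j)" if "j < m" for j
    using that by (auto simp: a_def m_def intro!: polyfun.add polyfun_diff polyfun.mult polyfun.const polyfun.coord P g)
qed (use X_closed Y_closed g \<Phi>_in_Y Y_point \<pi>_\<Phi> in auto)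

lemma Y_smooth: "smooth_variety m Y"
proof -
  obtain P where P: "finite P" "P \<subseteq> polys Q m" "Y = zero_set m P"
    using Y_algebraic unfolding algebraic_set_over_def by blast
  have "polys Q m \<subseteq> polys UNIV m" by (auto simp: polys_def)
  hence "algebraic_set_over UNIV m Y"
    unfolding algebraic_set_over_def using P by (intro exI[of _ P]) auto
  thus ?thesis
    using principal_open_chart.smooth_transfer[OF chart smooth] by (simp add: smooth_variety_def)
qed

lemma U_eq: "U = \<pi> ` Y"
  using \<Phi>_in_Y \<pi>_\<Phi>(1) Y_point(1,2) unfolding U_def
  by (auto intro!: image_eqI[where x = "\<Phi> x" for x])

text \<open>
  The points moved by \<open>L\<close> might all lie outside \<open>U\<close>. If conjugation fixed \<open>Y\<close>, however, \<open>Y\<close> and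
  therefore \<open>U\<close> would be finite, so that \<open>U\<close>, being closed and dense, is all of \<open>X\<close>.
\<close>

lemma conj_nontrivial: "\<exists>y\<in>Y. conj_map y \<noteq> y"
proof (rule ccontr)
  assume real: "\<not> ?thesis"
  hence "finite Y" by (intro zariski_closed_real_imp_finite[OF Y_closed]) auto
  hence "finite U" by (simp add: U_eq)
  hence "zariski_closed n U" using XC by (intro zariski_closed_finite) (auto simp: U_def)
  hence XU: "X \<subseteq> U" using U_dense by (simp add: zariski_closed_iff)
  obtain x where x: "x \<in> X" "L x \<noteq> x" using L_nontrivial by blast
  have gx: "g x \<noteq> 0" "g (L x) \<noteq> 0" using XU x(1) L_in by (auto simp: U_def)
  have "\<Phi> (L x) = \<Phi> x" using conj_\<Phi>[OF x(1) gx(1)] real \<Phi>_in_Y[OF x(1) gx(1)] by auto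
  hence "L x = x" using \<pi>_\<Phi>(1)[OF x(1) gx(1)] \<pi>_\<Phi>(1)[OF L_in[OF x(1)] gx(2)] by simp
  with x(2) show False by simp
qed

lemma real_isomorphic_Y: "real_isomorphic n X L m Y conj_map"
proof -
  have YC: "Y \<subseteq> Cn m" by (auto simp: Y_def)
  obtain r :: rat_tuple where r:
    "\<And>i. i < m \<Longrightarrow> fst (r i) \<in> polys UNIV n" "\<And>i. i < m \<Longrightarrow> snd (r i) \<in> polys UNIV n"
    "\<And>i x. i < m \<Longrightarrow> peval (fst (r i)) x = a i x" "\<And>i x. i < m \<Longrightarrow> peval (snd (r i)) x = g x"
    using rat_tuple_of_polyfuns[OF complex_subfield_UNIV, of m n a "\<lambda>_. g"]
      principal_open_chart.a[OF chart] g by metis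
  obtain q :: rat_tuple where q:
    "\<And>i. i < n \<Longrightarrow> fst (q i) \<in> polys UNIV m" "\<And>i. i < n \<Longrightarrow> snd (q i) \<in> polys UNIV m"
    "\<And>i x. i < n \<Longrightarrow> peval (fst (q i)) x = s i x" "\<And>i x. i < n \<Longrightarrow> peval (snd (q i)) x = 1"
    using rat_tuple_of_polyfuns[OF complex_subfield_UNIV, of n m s "\<lambda>_ _. 1"]
      principal_open_chart.s[OF chart] polyfun.const[of 1 UNIV m] by (metis UNIV_I)
  have rd: "rat_dom m r X = U" using r(4) by (auto simp: rat_dom_def U_def m_def)
  have re: "rat_eval m r x = \<Phi> x" for x
    using r(3,4) by (auto simp: rat_eval_def fraction_map_def)
  have qd: "rat_dom n q Y = Y" using q(4) by (auto simp: rat_dom_def)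
  have qe: "rat_eval n q y = \<pi> y" for y
    using q(3,4) by (auto simp: rat_eval_def tuple_map_def)
  have dU: "zariski_dense_in n X U" using U_dense by (auto simp: zariski_dense_in_def U_def)
  have dY: "zariski_dense_in m Y Y" by (rule zariski_dense_in_self[OF YC])
  have "rational_map UNIV n X m Y r"
    unfolding rational_map_def rd re using r(1,2) dU \<Phi>_in_Y by (auto simp: U_def)
  moreover have "rational_map UNIV m Y n X q"
    unfolding rational_map_def qd qe using q(1,2) dY Y_point(1) by auto
  moreover have "{x \<in> U. \<Phi> x \<in> Y \<and> \<pi> (\<Phi> x) = x} = U"
    using \<Phi>_in_Y \<pi>_\<Phi> by (auto simp: U_def)
  hence "rational_left_inverse n X m Y r q"
    unfolding rational_left_inverse_def rd re qd qe using dU by simp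
  moreover have "{y \<in> Y. \<pi> y \<in> U \<and> \<Phi> (\<pi> y) = y} = Y"
    using Y_point by (auto simp: U_def)
  hence "rational_left_inverse m Y n X q r"
    unfolding rational_left_inverse_def rd re qd qe using dY by simp
  moreover have "{y \<in> Y. L (\<pi> y) \<in> U \<and> conj_map y = \<Phi> (L (\<pi> y))} = Y"
  proof -
    have "L (\<pi> y) \<in> U" "conj_map y = \<Phi> (L (\<pi> y))" if "y \<in> Y" for y
      using Y_point[OF that] conj_\<Phi>[OF Y_point(1,2)[OF that]] L_U[of "\<pi> y"] by (auto simp: U_def)
    thus ?thesis by blast
  qed
  hence "zariski_dense_in m Y {y \<in> rat_dom n q Y. L (rat_eval n q y) \<in> rat_dom m r X \<and>
        conj_map y = rat_eval m r (L (rat_eval n q y))}"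
    unfolding rd re qd qe using dY by simp
  ultimately show ?thesis unfolding real_isomorphic_def birational_iso_def by blast
qed

lemma definable_over_real_subfield: "definable_over (Q \<inter> \<real>) n X L"
proof -
  have "symmetry m Y conj_map"
    by (rule conj_map_symmetry) (use Y_conj conj_nontrivial in \<open>auto simp: Y_def\<close>)
  moreover have "defined_over (Q \<inter> \<real>) m Y conj_map"
    by (intro conj_map_defined_over complex_subfield_Int_Reals Q Y_conj
        conj_invariant_imp_algebraic_over_reals[OF Q w Y_algebraic])
  ultimately show ?thesis
    unfolding definable_over_def real_algebraic_variety_def
    using Y_smooth real_isomorphic_Y by blast
qed

end

theorem theorem1:
  fixes Q :: "complex set" and n :: nat and X :: "cvec set" and L :: "cvec \<Rightarrow> cvec"
  assumes "subfield Q complex_ring"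
    and "cnj ` Q = Q"
    and "real_algebraic_variety n X L"
    and "defined_over Q n X L"
  shows "definable_over (Q \<inter> \<real>) n X L"
proof -
  have Q: "complex_subfield Q" by (rule subfield_imp_complex_subfield[OF assms(1)])
  have sym: "symmetry n X L" and smooth: "\<forall>x\<in>X. smooth_at n X x"
    using assms(3) by (auto simp: real_algebraic_variety_def smooth_variety_def)
  have alg: "algebraic_set_over Q n X" using assms(4) by (simp add: defined_over_def)
  have L_in: "L x \<in> X" if "x \<in> X" for x
    using sym that by (auto simp: symmetry_def bij_betw_def)
  show ?thesis
  proof (cases "Q \<subseteq> \<real>")
    case True
    hence "Q \<inter> \<real> = Q" by blast
    moreover have "X \<subseteq> Cn n"
      using algebraic_imp_zariski_closed[OF Q alg] by (rule zariski_closed_subset_Cn)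
    ultimately show ?thesis
      unfolding definable_over_def using assms(3,4) real_isomorphic_refl[of X n L] L_in by metis
  next
    case False
    then obtain q where q: "q \<in> Q" "q \<notin> \<real>" by blast
    \<comment> \<open>This is \<open>2 \<ii> Im q\<close>; \<open>\<ii>\<close> itself need not lie in \<open>Q\<close>.\<close>
    define w where "w = q - cnj q"
    have w: "w \<in> Q" "cnj w = - w" "w \<noteq> 0"
      using q assms(2) complex_subfield_diff[OF Q] by (auto simp: w_def Reals_cnj_iff)
    obtain eqs where eqs: "finite eqs" "\<And>f. f \<in> eqs \<Longrightarrow> polyfun Q n f"
      "X = {x\<in>Cn n. \<forall>f\<in>eqs. f x = 0}"
      using alg unfolding algebraic_set_over_iff[OF Q] by blast
    obtain p where p: "\<forall>i<n. p i \<in> polys UNIV n"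
      "\<forall>x\<in>X. (conj_map \<circ> L) x = (\<lambda>i. if i < n then peval (p i) x else 0)"
      using sym unfolding symmetry_def biregular_iso_def regular_map_def by blast
    obtain r where r: "rational_map Q n X n (conj_map ` X) r"
      "\<forall>x\<in>rat_dom n r X. (conj_map \<circ> L) x = rat_eval n r x"
      using assms(4) unfolding defined_over_def map_defined_over_def by blast
    have data: "conjugation_data Q n X L w eqs (\<lambda>i. peval (p i))
      (\<lambda>i. peval (fst (r i))) (\<lambda>i. peval (snd (r i)))"
    proof
      show "X \<subseteq> zariski_closure n {x \<in> X. \<forall>i<n. peval (snd (r i)) x \<noteq> 0}"
        using r(1) by (simp add: rational_map_def zariski_dense_in_def rat_dom_def)
      show "peval (p i) x = peval (fst (r i)) x / peval (snd (r i)) x"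
        if "x \<in> X" "\<forall>i<n. peval (snd (r i)) x \<noteq> 0" "i < n" for x i
      proof -
        have "(conj_map \<circ> L) x i = rat_eval n r x i" using r(2) that by (auto simp: rat_dom_def)
        thus ?thesis using p(2) that by (auto simp: rat_eval_def)
      qed
      show "polyfun Q n (peval (fst (r i)))" "polyfun Q n (peval (snd (r i)))" if "i < n" for i
        using r(1) that polyfun_peval[OF Q] by (auto simp: rational_map_def)
    qed (use Q assms(2) w eqs L_in sym smooth p polyfun_peval in
        \<open>auto simp: symmetry_def tuple_map_def\<close>)
    show ?thesis by (rule conjugation_data.definable_over_real_subfield[OF data])
  qed
qed

end
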